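(* Let $I\subset\mathbb{R}$ be an open interval and let $\gamma:I\to\mathbb{H}_3$ be a smooth non-geodesic curve parametrized by arc length in the Heisenberg group $(\mathbb{H}_3,g)$, with geodesic curvature $k$, geodesic torsion $\tau$ and Frenet frame $\{T,N,B\}$. Then $\gamma$ is biharmonic if and only if $$ \begin{cases} k=\text{constant}\neq 0,\\ \tau=\text{constant},\\ N_3B_3=0,\\ k^2+\tau^2=\frac14-B_3^2 \end{cases} $$ on $I$.
   Context: The Heisenberg group $\mathbb{H}_3$ is $\mathbb{R}^3$ with the multiplication $(\tilde x,\tilde y,\tilde z)(x,y,z)=(\tilde x+x,\tilde y+y,\tilde z+z+\frac12\tilde x y-\frac12\tilde y x)$ and the left-invariant Riemannian metric $g=dx^2+dy^2+(dz+\frac y2dx-\frac x2dy)^2$. A left-invariant orthonormal frame, taken as positively oriented, is $e_1=\partial_x-\frac12y\,\partial_z$, $e_2=\partial_y+\frac12x\,\partial_z$, $e_3=\partial_z$. $\nabla$ is the Levi-Civita connection of $g$, and the curvature sign convention is $R(X,Y)Z=-\nabla_X\nabla_YZ+\nabla_Y\nabla_XZ+\nabla_{[X,Y]}Z$. Everything is smooth ($C^\infty$). For a curve $\gamma$ parametrized by arc length with $T=\gamma'$: $\gamma$ is a geodesic if $\nabla_TT=0$ identically, and non-geodesic otherwise; $\gamma$ is biharmonic if $\tau_2(\gamma)=\nabla_T\nabla_T\nabla_TT+R(T,\nabla_TT)T=0$. Frenet apparatus: $k=|\nabla_TT|$ is the geodesic curvature; where $k\neq0$, $N$ is the unit vector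 field with $\nabla_TT=kN$, $B=T\times N$ (so that $\{T,N,B\}$ is a positively oriented orthonormal frame), and the geodesic torsion $\tau$ is defined by the Frenet equations $\nabla_TT=kN$, $\nabla_TN=-kT-\tau B$, $\nabla_TB=\tau N$. Components are taken with respect to $e_1,e_2,e_3$: $T=\sum T_ie_i$, $N=\sum N_ie_i$, $B=\sum B_ie_i$. $N$, $B$, $\tau$ are defined only where $k\ne0$ (which is guaranteed once $k$ is a nonzero constant). *)

theory Defs
  imports "HOL-Analysis.Analysis"
begin

section \<open>Smooth maps\<close>

text \<open>Only meant for open sets: derivatives are taken in the full space.\<close>

primrec Ck_on :: "nat \<Rightarrow> 'a::euclidean_space set \<Rightarrow> ('a \<Rightarrow> 'b::real_normed_vector) \<Rightarrow> bool" where
  "Ck_on 0 S f \<longleftrightarrow> continuous_on S f"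
| "Ck_on (Suc k) S f \<longleftrightarrow>
     (\<forall>x\<in>S. f differentiable (at x)) \<and> (\<forall>v. Ck_on k S (\<lambda>x. frechet_derivative f (at x) v))"

definition smooth_on :: "'a::euclidean_space set \<Rightarrow> ('a \<Rightarrow> 'b::real_normed_vector) \<Rightarrow> bool" where
  "smooth_on S f \<longleftrightarrow> (\<forall>k. Ck_on k S f)"

abbreviation smooth :: "('a::euclidean_space \<Rightarrow> 'b::real_normed_vector) \<Rightarrow> bool" where
  "smooth \<equiv> smooth_on UNIV"


section \<open>Connections and curvature on a Euclidean coordinate space\<close>

text \<open>
  The manifold is a Euclidean space with its global chart, so a vector field is a map
  \<open>'a \<Rightarrow> 'a\<close>, and a Riemannian metric \<open>g\<close> assigns to a point \<open>p\<close> the inner product \<open>g p\<close>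
  of tangent vectors at \<open>p\<close>.
\<close>

definition dir_deriv :: "('a::euclidean_space \<Rightarrow> 'a) \<Rightarrow> ('a \<Rightarrow> 'b::real_normed_vector) \<Rightarrow> 'a \<Rightarrow> 'b" where
  "dir_deriv X f p = frechet_derivative f (at p) (X p)"

definition lie_bracket :: "('a::euclidean_space \<Rightarrow> 'a) \<Rightarrow> ('a \<Rightarrow> 'a) \<Rightarrow> 'a \<Rightarrow> 'a" where
  "lie_bracket X Y p = dir_deriv X Y p - dir_deriv Y X p"

definition affine_connection ::
    "(('a::euclidean_space \<Rightarrow> 'a) \<Rightarrow> ('a \<Rightarrow> 'a) \<Rightarrow> 'a \<Rightarrow> 'a) \<Rightarrow> bool" where
  "affine_connection nabla \<longleftrightarrow>
     (\<forall>X Y. smooth X \<longrightarrow> smooth Y \<longrightarrow> smooth (nabla X Y)) \<and>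
     (\<forall>X X' Y p. smooth X \<longrightarrow> smooth X' \<longrightarrow> smooth Y \<longrightarrow>
        nabla (\<lambda>q. X q + X' q) Y p = nabla X Y p + nabla X' Y p) \<and>
     (\<forall>f X Y p. smooth (f :: 'a \<Rightarrow> real) \<longrightarrow> smooth X \<longrightarrow> smooth Y \<longrightarrow>
        nabla (\<lambda>q. f q *\<^sub>R X q) Y p = f p *\<^sub>R nabla X Y p) \<and>
     (\<forall>X Y Y' p. smooth X \<longrightarrow> smooth Y \<longrightarrow> smooth Y' \<longrightarrow>
        nabla X (\<lambda>q. Y q + Y' q) p = nabla X Y p + nabla X Y' p) \<and>
     (\<forall>f X Y p. smooth (f :: 'a \<Rightarrow> real) \<longrightarrow> smooth X \<longrightarrow> smooth Y \<longrightarrow>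
        nabla X (\<lambda>q. f q *\<^sub>R Y q) p = dir_deriv X f p *\<^sub>R Y p + f p *\<^sub>R nabla X Y p)"

definition levi_civita ::
    "('a::euclidean_space \<Rightarrow> 'a \<Rightarrow> 'a \<Rightarrow> real) \<Rightarrow>
     (('a \<Rightarrow> 'a) \<Rightarrow> ('a \<Rightarrow> 'a) \<Rightarrow> 'a \<Rightarrow> 'a) \<Rightarrow> bool" where
  "levi_civita g nabla \<longleftrightarrow>
     affine_connection nabla \<and>
     (\<forall>X Y p. smooth X \<longrightarrow> smooth Y \<longrightarrow>
        nabla X Y p - nabla Y X p = lie_bracket X Y p) \<and>
     (\<forall>X Y Z p. smooth X \<longrightarrow> smooth Y \<longrightarrow> smooth Z \<longrightarrow>
        dir_deriv X (\<lambda>q. g q (Y q) (Z q)) p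
          = g p (nabla X Y p) (Z p) + g p (Y p) (nabla X Z p))"

text \<open>The sign convention is opposite to the one with \<open>R(X,Y) = [\<nabla>\<^sub>X, \<nabla>\<^sub>Y] - \<nabla>\<^bsub>[X,Y]\<^esub>\<close>.\<close>

definition curvature ::
    "(('a::euclidean_space \<Rightarrow> 'a) \<Rightarrow> ('a \<Rightarrow> 'a) \<Rightarrow> 'a \<Rightarrow> 'a) \<Rightarrow>
     ('a \<Rightarrow> 'a) \<Rightarrow> ('a \<Rightarrow> 'a) \<Rightarrow> ('a \<Rightarrow> 'a) \<Rightarrow> 'a \<Rightarrow> 'a" where
  "curvature nabla X Y Z p =
     - nabla X (nabla Y Z) p + nabla Y (nabla X Z) p + nabla (lie_bracket X Y) Z p"

text \<open>
  The curvature is tensorial, so its value on tangent vectors at \<open>p\<close> may be computed with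
  any smooth extensions; here they are extended with constant coordinates.
\<close>

definition curvature_at ::
    "(('a::euclidean_space \<Rightarrow> 'a) \<Rightarrow> ('a \<Rightarrow> 'a) \<Rightarrow> 'a \<Rightarrow> 'a) \<Rightarrow> 'a \<Rightarrow> 'a \<Rightarrow> 'a \<Rightarrow> 'a \<Rightarrow> 'a" where
  "curvature_at nabla p u v w = curvature nabla (\<lambda>_. u) (\<lambda>_. v) (\<lambda>_. w) p"


section \<open>Vector fields along curves\<close>

definition velocity :: "(real \<Rightarrow> 'a::euclidean_space) \<Rightarrow> real \<Rightarrow> 'a" where
  "velocity \<gamma> t = vector_derivative \<gamma> (at t)"

text \<open>
  Covariant derivative of a vector field \<open>V\<close> along \<open>\<gamma>\<close>, written \<open>\<nabla>\<^sub>T V\<close> for \<open>T = \<gamma>'\<close>. With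
  \<open>V = \<Sum>\<^sub>i V\<^sub>i \<partial>\<^sub>i\<close> it is \<open>\<Sum>\<^sub>i (V\<^sub>i' \<partial>\<^sub>i + V\<^sub>i \<nabla>\<^sub>T \<partial>\<^sub>i)\<close>, and the constants \<open>V\<^sub>i(t)\<close> can be
  moved inside \<open>\<nabla>\<close>. Lemma \<open>cov_deriv_restrict\<close> below checks it on restrictions of ambient
  vector fields.
\<close>

definition cov_deriv ::
    "(('a::euclidean_space \<Rightarrow> 'a) \<Rightarrow> ('a \<Rightarrow> 'a) \<Rightarrow> 'a \<Rightarrow> 'a) \<Rightarrow>
     (real \<Rightarrow> 'a) \<Rightarrow> (real \<Rightarrow> 'a) \<Rightarrow> real \<Rightarrow> 'a" where
  "cov_deriv nabla \<gamma> V t =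
     vector_derivative V (at t) + nabla (\<lambda>_. velocity \<gamma> t) (\<lambda>_. V t) (\<gamma> t)"

definition arc_length_param ::
    "('a::euclidean_space \<Rightarrow> 'a \<Rightarrow> 'a \<Rightarrow> real) \<Rightarrow> (real \<Rightarrow> 'a) \<Rightarrow> real set \<Rightarrow> bool" where
  "arc_length_param g \<gamma> I \<longleftrightarrow> (\<forall>t\<in>I. sqrt (g (\<gamma> t) (velocity \<gamma> t) (velocity \<gamma> t)) = 1)"

definition geodesic ::
    "(('a::euclidean_space \<Rightarrow> 'a) \<Rightarrow> ('a \<Rightarrow> 'a) \<Rightarrow> 'a \<Rightarrow> 'a) \<Rightarrow> (real \<Rightarrow> 'a) \<Rightarrow> real set \<Rightarrow> bool" where
  "geodesic nabla \<gamma> I \<longleftrightarrow> (\<forall>t\<in>I. cov_deriv nabla \<gamma> (velocity \<gamma>) t = 0)"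

definition bitension ::
    "(('a::euclidean_space \<Rightarrow> 'a) \<Rightarrow> ('a \<Rightarrow> 'a) \<Rightarrow> 'a \<Rightarrow> 'a) \<Rightarrow> (real \<Rightarrow> 'a) \<Rightarrow> real \<Rightarrow> 'a" where
  "bitension nabla \<gamma> t =
     cov_deriv nabla \<gamma> (cov_deriv nabla \<gamma> (cov_deriv nabla \<gamma> (velocity \<gamma>))) t
     + curvature_at nabla (\<gamma> t) (velocity \<gamma> t) (cov_deriv nabla \<gamma> (velocity \<gamma>) t) (velocity \<gamma> t)"

definition biharmonic ::
    "(('a::euclidean_space \<Rightarrow> 'a) \<Rightarrow> ('a \<Rightarrow> 'a) \<Rightarrow> 'a \<Rightarrow> 'a) \<Rightarrow> (real \<Rightarrow> 'a) \<Rightarrow> real set \<Rightarrow> bool" where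
  "biharmonic nabla \<gamma> I \<longleftrightarrow> (\<forall>t\<in>I. bitension nabla \<gamma> t = 0)"


section \<open>The Heisenberg group\<close>

definition heis_mult :: "real^3 \<Rightarrow> real^3 \<Rightarrow> real^3" where
  "heis_mult q p =
     vector [q$1 + p$1, q$2 + p$2, q$3 + p$3 + 1/2 * q$1 * p$2 - 1/2 * q$2 * p$1]"

definition heis_metric :: "real^3 \<Rightarrow> real^3 \<Rightarrow> real^3 \<Rightarrow> real" where
  "heis_metric p u v =
     u$1 * v$1 + u$2 * v$2
     + (u$3 + p$2/2 * u$1 - p$1/2 * u$2) * (v$3 + p$2/2 * v$1 - p$1/2 * v$2)"

definition heis_frame :: "3 \<Rightarrow> real^3 \<Rightarrow> real^3" where
  "heis_frame i p =
     (if i = 1 then vector [1, 0, - (1/2) * p$2]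
      else if i = 2 then vector [0, 1, 1/2 * p$1]
      else vector [0, 0, 1])"

text \<open>Since the frame is orthonormal, these are the coefficients of \<open>v\<close> in it; see \<open>heis_comp_frame\<close>.\<close>

definition heis_comp :: "real^3 \<Rightarrow> real^3 \<Rightarrow> real^3" where
  "heis_comp p v = (\<chi> i. heis_metric p v (heis_frame i p))"

text \<open>The cross product of the tangent space for which \<open>e\<^sub>1, e\<^sub>2, e\<^sub>3\<close> is positively oriented.\<close>

definition heis_cross :: "real^3 \<Rightarrow> real^3 \<Rightarrow> real^3 \<Rightarrow> real^3" where
  "heis_cross p u v =
     (\<Sum>i\<in>UNIV. (cross3 (heis_comp p u) (heis_comp p v) $ i) *\<^sub>R heis_frame i p)"


section \<open>Frenet apparatus in the Heisenberg group\<close>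

text \<open>The values of \<open>frenet_N\<close>, \<open>frenet_B\<close> and \<open>frenet_torsion\<close> matter only where the
  geodesic curvature does not vanish.\<close>

definition geod_curvature ::
    "((real^3 \<Rightarrow> real^3) \<Rightarrow> (real^3 \<Rightarrow> real^3) \<Rightarrow> real^3 \<Rightarrow> real^3) \<Rightarrow> (real \<Rightarrow> real^3) \<Rightarrow> real \<Rightarrow> real" where
  "geod_curvature nabla \<gamma> t =
     sqrt (heis_metric (\<gamma> t) (cov_deriv nabla \<gamma> (velocity \<gamma>) t) (cov_deriv nabla \<gamma> (velocity \<gamma>) t))"

definition frenet_N ::
    "((real^3 \<Rightarrow> real^3) \<Rightarrow> (real^3 \<Rightarrow> real^3) \<Rightarrow> real^3 \<Rightarrow> real^3) \<Rightarrow> (real \<Rightarrow> real^3) \<Rightarrow> real \<Rightarrow> real^3" where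
  "frenet_N nabla \<gamma> t = (1 / geod_curvature nabla \<gamma> t) *\<^sub>R cov_deriv nabla \<gamma> (velocity \<gamma>) t"

definition frenet_B ::
    "((real^3 \<Rightarrow> real^3) \<Rightarrow> (real^3 \<Rightarrow> real^3) \<Rightarrow> real^3 \<Rightarrow> real^3) \<Rightarrow> (real \<Rightarrow> real^3) \<Rightarrow> real \<Rightarrow> real^3" where
  "frenet_B nabla \<gamma> t = heis_cross (\<gamma> t) (velocity \<gamma> t) (frenet_N nabla \<gamma> t)"

definition frenet_torsion ::
    "((real^3 \<Rightarrow> real^3) \<Rightarrow> (real^3 \<Rightarrow> real^3) \<Rightarrow> real^3 \<Rightarrow> real^3) \<Rightarrow> (real \<Rightarrow> real^3) \<Rightarrow> real \<Rightarrow> real" where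
  "frenet_torsion nabla \<gamma> t = (THE s.
     cov_deriv nabla \<gamma> (frenet_N nabla \<gamma>) t
       = - geod_curvature nabla \<gamma> t *\<^sub>R velocity \<gamma> t - s *\<^sub>R frenet_B nabla \<gamma> t \<and>
     cov_deriv nabla \<gamma> (frenet_B nabla \<gamma>) t = s *\<^sub>R frenet_N nabla \<gamma> t)"


section \<open>Consistency of the definitions\<close>

subsection \<open>Basic properties of smooth maps\<close>

lemma Ck_UNIV_Suc_I:
  assumes "\<And>x. (f has_derivative f' x) (at x)" "\<And>v. Ck_on k UNIV (\<lambda>x. f' x v)"
  shows "Ck_on (Suc k) UNIV f"
proof -
  have "frechet_derivative f (at x) = f' x" for x
    using assms(1) frechet_derivative_at by metis
  then show ?thesis
    using assms by (auto simp: differentiable_def)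
qed

lemma Ck_UNIV_Suc_D:
  assumes "Ck_on (Suc k) UNIV f"
  shows "(f has_derivative frechet_derivative f (at x)) (at x)"
  using assms frechet_derivative_works by auto

lemma Ck_UNIV_mono: "Ck_on (Suc k) UNIV f \<Longrightarrow> Ck_on k UNIV f"
proof (induction k arbitrary: f)
  case 0
  then show ?case
    by (auto intro!: differentiable_imp_continuous_on simp: differentiable_on_def
        intro: differentiable_at_withinI)
next
  case (Suc k)
  then show ?case by (metis Ck_on.simps(2))
qed

lemma Ck_UNIV_const: "Ck_on k UNIV (\<lambda>_. c)"
proof (induction k arbitrary: c)
  case (Suc k)
  show ?case
    by (rule Ck_UNIV_Suc_I[where f' = "\<lambda>_ _. 0"]) (auto intro!: Suc derivative_eq_intros)
qed simp

lemma Ck_UNIV_add: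
  "Ck_on k UNIV f \<Longrightarrow> Ck_on k UNIV g \<Longrightarrow> Ck_on k UNIV (\<lambda>x. f x + g x)"
proof (induction k arbitrary: f g)
  case 0
  then show ?case by (auto intro: continuous_on_add)
next
  case (Suc k)
  show ?case
    by (rule Ck_UNIV_Suc_I[OF has_derivative_add[OF Ck_UNIV_Suc_D[OF Suc.prems(1)]
            Ck_UNIV_Suc_D[OF Suc.prems(2)]]])
      (use Suc in auto)
qed

lemma Ck_UNIV_bilinear:
  assumes "bounded_bilinear h"
  shows "Ck_on k UNIV f \<Longrightarrow> Ck_on k UNIV g \<Longrightarrow> Ck_on k UNIV (\<lambda>x. h (f x) (g x))"
proof (induction k arbitrary: f g)
  case 0
  then show ?case by (auto intro: bounded_bilinear.continuous_on[OF assms])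
next
  case (Suc k)
  show ?case
    by (rule Ck_UNIV_Suc_I[OF bounded_bilinear.FDERIV[OF assms Ck_UNIV_Suc_D[OF Suc.prems(1)]
            Ck_UNIV_Suc_D[OF Suc.prems(2)]]])
      (use Suc Ck_UNIV_mono[OF Suc.prems(1)] Ck_UNIV_mono[OF Suc.prems(2)] in
        \<open>auto intro!: Ck_UNIV_add\<close>)
qed

lemma Ck_UNIV_bounded_linear: "bounded_linear f \<Longrightarrow> Ck_on k UNIV f"
proof (cases k)
  case (Suc n)
  assume "bounded_linear f"
  then show ?thesis unfolding Suc
    by (intro Ck_UNIV_Suc_I[where f' = "\<lambda>_. f"] Ck_UNIV_const bounded_linear_imp_has_derivative)
qed (simp add: linear_continuous_on)

lemma smooth_const [simp]: "smooth (\<lambda>_. c)"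
  by (simp add: smooth_on_def Ck_UNIV_const)

lemma smooth_add: "smooth f \<Longrightarrow> smooth g \<Longrightarrow> smooth (\<lambda>x. f x + g x)"
  by (simp add: smooth_on_def Ck_UNIV_add)

lemma smooth_scaleR: "smooth f \<Longrightarrow> smooth g \<Longrightarrow> smooth (\<lambda>x. f x *\<^sub>R g x)"
  by (simp add: smooth_on_def Ck_UNIV_bilinear[OF bounded_bilinear_scaleR])

lemma smooth_mult:
  fixes f g :: "'a::euclidean_space \<Rightarrow> real"
  shows "smooth f \<Longrightarrow> smooth g \<Longrightarrow> smooth (\<lambda>x. f x * g x)"
  by (simp add: smooth_on_def Ck_UNIV_bilinear[OF bounded_bilinear_mult])

lemma smooth_inner: "smooth f \<Longrightarrow> smooth g \<Longrightarrow> smooth (\<lambda>x. f x \<bullet> g x)"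
  by (simp add: smooth_on_def Ck_UNIV_bilinear[OF bounded_bilinear_inner])

lemma smooth_minus: "smooth f \<Longrightarrow> smooth (\<lambda>x. - f x)"
  using smooth_scaleR[of "\<lambda>_. -1" f] by simp

lemma smooth_sum: "(\<And>i. i \<in> A \<Longrightarrow> smooth (f i)) \<Longrightarrow> smooth (\<lambda>x. \<Sum>i\<in>A. f i x)"
  by (induction A rule: infinite_finite_induct) (auto intro: smooth_add)

lemma smooth_bounded_linear: "bounded_linear f \<Longrightarrow> smooth f"
  by (simp add: smooth_on_def Ck_UNIV_bounded_linear)

lemma smooth_component: "smooth f \<Longrightarrow> smooth (\<lambda>x. f x $ i :: real)" for f :: "_ \<Rightarrow> real^'n"
  using smooth_inner[of f "\<lambda>_. axis i 1"] by (simp add: inner_axis)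

lemma smooth_has_derivative:
  "smooth f \<Longrightarrow> (f has_derivative frechet_derivative f (at x)) (at x)"
  unfolding smooth_on_def using Ck_UNIV_Suc_D by blast

lemma smooth_frechet: "smooth f \<Longrightarrow> smooth (\<lambda>x. frechet_derivative f (at x) v)"
  unfolding smooth_on_def using Ck_on.simps(2) by blast

lemma smooth_dir_deriv:
  assumes "smooth X" "smooth f"
  shows "smooth (dir_deriv X f)"
proof -
  have "dir_deriv X f = (\<lambda>p. \<Sum>b\<in>Basis. (X p \<bullet> b) *\<^sub>R frechet_derivative f (at p) b)"
  proof
    fix p
    interpret bounded_linear "frechet_derivative f (at p)"
      using smooth_has_derivative[OF assms(2)] by (rule has_derivative_bounded_linear)
    have "dir_deriv X f p = frechet_derivative f (at p) (\<Sum>b\<in>Basis. (X p \<bullet> b) *\<^sub>R b)"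
      by (simp add: dir_deriv_def euclidean_representation)
    then show "dir_deriv X f p = (\<Sum>b\<in>Basis. (X p \<bullet> b) *\<^sub>R frechet_derivative f (at p) b)"
      by (simp add: sum scaleR)
  qed
  then show ?thesis
    using assms by (auto intro!: smooth_sum smooth_scaleR smooth_inner smooth_frechet)
qed

lemma dir_deriv_eq: "(f has_derivative f') (at p) \<Longrightarrow> dir_deriv X f p = f' (X p)"
  unfolding dir_deriv_def using frechet_derivative_at by metis


subsection \<open>Covariant derivative along curves of restricted ambient fields\<close>

lemma affine_connection_add:
  assumes "affine_connection nabla" "smooth X" "smooth Y" "smooth Y'"
  shows "nabla X (\<lambda>q. Y q + Y' q) p = nabla X Y p + nabla X Y' p"
proof -
  have "\<forall>X Y Y' p. smooth X \<longrightarrow> smooth Y \<longrightarrow> smooth Y' \<longrightarrow>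
      nabla X (\<lambda>q. Y q + Y' q) p = nabla X Y p + nabla X Y' p"
    using assms(1) unfolding affine_connection_def by (elim conjE)
  from this[rule_format, OF assms(2-4)] show ?thesis .
qed

lemma affine_connection_Leibniz:
  fixes f :: "'a::euclidean_space \<Rightarrow> real"
  assumes "affine_connection nabla" "smooth f" "smooth X" "smooth Y"
  shows "nabla X (\<lambda>q. f q *\<^sub>R Y q) p = dir_deriv X f p *\<^sub>R Y p + f p *\<^sub>R nabla X Y p"
proof -
  have "\<forall>f X Y p. smooth (f :: 'a \<Rightarrow> real) \<longrightarrow> smooth X \<longrightarrow> smooth Y \<longrightarrow>
      nabla X (\<lambda>q. f q *\<^sub>R Y q) p = dir_deriv X f p *\<^sub>R Y p + f p *\<^sub>R nabla X Y p"
    using assms(1) unfolding affine_connection_def by (elim conjE)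
  from this[rule_format, OF assms(2-4)] show ?thesis .
qed

lemma cov_deriv_restrict:
  fixes \<gamma> :: "real \<Rightarrow> 'a::euclidean_space"
  assumes nabla: "affine_connection nabla" and Y: "smooth Y"
    and \<gamma>: "\<gamma> differentiable (at t)"
  shows "cov_deriv nabla \<gamma> (\<lambda>s. Y (\<gamma> s)) t = nabla (\<lambda>_. velocity \<gamma> t) Y (\<gamma> t)"
proof -
  define u where "u = velocity \<gamma> t"
  have D: "((\<lambda>q. Y q \<bullet> b) has_derivative (\<lambda>v. frechet_derivative Y (at p) v \<bullet> b)) (at p)" for b p
    using smooth_has_derivative[OF Y] by (auto intro!: derivative_eq_intros)
  have zero: "nabla X (\<lambda>_. 0) p = 0" if "smooth X" for X p
    using affine_connection_Leibniz[OF nabla smooth_const[of 0] that smooth_const[of 0]] by simp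
  have sum: "nabla X (\<lambda>q. \<Sum>b\<in>A. Z b q) p = (\<Sum>b\<in>A. nabla X (Z b) p)"
    if "smooth X" "\<And>b. smooth (Z b)" "finite A" for X Z p and A :: "'a set"
    using that(3)
  proof (induction A rule: finite_induct)
    case (insert b A)
    have "nabla X (\<lambda>q. Z b q + (\<Sum>b\<in>A. Z b q)) p
        = nabla X (Z b) p + nabla X (\<lambda>q. \<Sum>b\<in>A. Z b q) p"
      by (intro affine_connection_add[OF nabla] that smooth_sum)
    with insert show ?case by simp
  qed (simp add: zero that)
  have leib: "nabla (\<lambda>_. u) (\<lambda>q. f q *\<^sub>R b) p
      = dir_deriv (\<lambda>_. u) f p *\<^sub>R b + f p *\<^sub>R nabla (\<lambda>_. u) (\<lambda>_. b) p"
    if "smooth f" for f b p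
    by (intro affine_connection_Leibniz[OF nabla that] smooth_const)
  have rep: "nabla (\<lambda>_. u) Z p
      = (\<Sum>b\<in>Basis. dir_deriv (\<lambda>_. u) (\<lambda>q. Z q \<bullet> b) p *\<^sub>R b + (Z p \<bullet> b) *\<^sub>R nabla (\<lambda>_. u) (\<lambda>_. b) p)"
    if Z: "smooth Z" for Z p
  proof -
    have "nabla (\<lambda>_. u) Z p = nabla (\<lambda>_. u) (\<lambda>q. \<Sum>b\<in>Basis. (Z q \<bullet> b) *\<^sub>R b) p"
      by (simp add: euclidean_representation)
    also have "\<dots> = (\<Sum>b\<in>Basis. nabla (\<lambda>_. u) (\<lambda>q. (Z q \<bullet> b) *\<^sub>R b) p)"
      using Z by (intro sum) (auto intro!: smooth_scaleR smooth_inner)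
    finally show ?thesis
      using Z by (simp add: leib smooth_inner)
  qed
  have "nabla (\<lambda>_. u) Y (\<gamma> t)
      = (\<Sum>b\<in>Basis. (frechet_derivative Y (at (\<gamma> t)) u \<bullet> b) *\<^sub>R b
          + (Y (\<gamma> t) \<bullet> b) *\<^sub>R nabla (\<lambda>_. u) (\<lambda>_. b) (\<gamma> t))"
    by (simp add: rep[OF Y] dir_deriv_eq[OF D])
  also have "\<dots> = frechet_derivative Y (at (\<gamma> t)) u
      + (\<Sum>b\<in>Basis. (Y (\<gamma> t) \<bullet> b) *\<^sub>R nabla (\<lambda>_. u) (\<lambda>_. b) (\<gamma> t))"
    by (simp add: sum.distrib euclidean_representation)
  also have "(\<Sum>b\<in>Basis. (Y (\<gamma> t) \<bullet> b) *\<^sub>R nabla (\<lambda>_. u) (\<lambda>_. b) (\<gamma> t))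
      = nabla (\<lambda>_. u) (\<lambda>_. Y (\<gamma> t)) (\<gamma> t)"
    by (subst rep) (simp_all add: dir_deriv_eq[OF has_derivative_const])
  also have "frechet_derivative Y (at (\<gamma> t)) u = vector_derivative (\<lambda>s. Y (\<gamma> s)) (at t)"
  proof -
    have "(\<gamma> has_vector_derivative u) (at t)"
      using \<gamma> by (simp add: u_def velocity_def vector_derivative_works[symmetric])
    then have "((\<lambda>s. Y (\<gamma> s)) has_vector_derivative frechet_derivative Y (at (\<gamma> t)) u) (at t)"
      using vector_derivative_diff_chain_within[of \<gamma> u t UNIV Y]
        smooth_has_derivative[OF Y] by (simp add: o_def has_derivative_at_withinI)
    then show ?thesis by (simp add: vector_derivative_at)
  qed
  finally show ?thesis by (simp add: cov_deriv_def u_def)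
qed


subsection \<open>The Heisenberg metric and its frame\<close>

lemma heis_metric_pos: "u \<noteq> 0 \<Longrightarrow> heis_metric p u u > 0"
proof (rule ccontr)
  assume "u \<noteq> 0" "\<not> heis_metric p u u > 0"
  then have "u$1 * u$1 + u$2 * u$2
      + (u$3 + p$2/2 * u$1 - p$1/2 * u$2) * (u$3 + p$2/2 * u$1 - p$1/2 * u$2) \<le> 0"
    by (simp add: heis_metric_def)
  then have "u$1 = 0" "u$2 = 0" "u$3 + p$2/2 * u$1 - p$1/2 * u$2 = 0"
    by (smt (verit) mult_eq_0_iff zero_le_square)+
  with \<open>u \<noteq> 0\<close> show False by (simp add: vec_eq_iff forall_3)
qed

lemma heis_frame_orthonormal:
  "heis_metric p (heis_frame i p) (heis_frame j p) = (if i = j then 1 else 0)"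
  using exhaust_3[of i] exhaust_3[of j] by (auto simp: heis_metric_def heis_frame_def)

lemma heis_comp_frame: "(\<Sum>i\<in>UNIV. (heis_comp p v $ i) *\<^sub>R heis_frame i p) = v"
  by (simp add: vec_eq_iff forall_3 sum_3 heis_comp_def heis_metric_def heis_frame_def field_simps)

lemma has_derivative_heis_mult:
  "(heis_mult q has_derivative
     (\<lambda>v. vector [v$1, v$2, v$3 + 1/2 * q$1 * v$2 - 1/2 * q$2 * v$1])) (at p)"
proof -
  let ?L = "\<lambda>v. vector [v$1, v$2, v$3 + 1/2 * q$1 * v$2 - 1/2 * q$2 * v$1] :: real^3"
  have "linear ?L"
    by (rule linearI) (simp_all add: vec_eq_iff forall_3 field_simps)
  then have "((\<lambda>x. q + ?L x) has_derivative ?L) (at p)"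
    by (auto intro!: has_derivative_eq_rhs[OF has_derivative_add[OF has_derivative_const
          bounded_linear_imp_has_derivative]] simp: linear_conv_bounded_linear)
  moreover have "heis_mult q = (\<lambda>x. q + ?L x)"
    by (simp add: fun_eq_iff heis_mult_def vec_eq_iff forall_3)
  ultimately show ?thesis by simp
qed

lemma heis_frame_left_invariant:
  "frechet_derivative (heis_mult q) (at p) (heis_frame i p) = heis_frame i (heis_mult q p)"
  unfolding frechet_derivative_at[OF has_derivative_heis_mult, symmetric]
  using exhaust_3[of i]
  by (auto simp: vec_eq_iff forall_3 heis_frame_def heis_mult_def field_simps)

lemma heis_metric_left_invariant:
  "heis_metric (heis_mult q p) (frechet_derivative (heis_mult q) (at p) u)
     (frechet_derivative (heis_mult q) (at p) v) = heis_metric p u v"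
  unfolding frechet_derivative_at[OF has_derivative_heis_mult, symmetric]
  by (simp add: heis_metric_def heis_mult_def field_simps)


subsection \<open>Existence of the Levi-Civita connection of the Heisenberg group\<close>

definition heis_form :: "real^3 \<Rightarrow> real^3 \<Rightarrow> real" where
  "heis_form p u = u$3 + p$2/2 * u$1 - p$1/2 * u$2"

definition heis_christoffel :: "real^3 \<Rightarrow> real^3 \<Rightarrow> real^3 \<Rightarrow> real^3" where
  "heis_christoffel p u v =
     (let a = (heis_form p v * u$2 + heis_form p u * v$2) / 2;
          b = - (heis_form p v * u$1 + heis_form p u * v$1) / 2
      in vector [a, b, p$1/2 * b - p$2/2 * a])"

definition heis_nabla ::
    "(real^3 \<Rightarrow> real^3) \<Rightarrow> (real^3 \<Rightarrow> real^3) \<Rightarrow> real^3 \<Rightarrow> real^3" where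
  "heis_nabla X Y p = dir_deriv X Y p + heis_christoffel p (X p) (Y p)"

lemma smooth_vector3:
  assumes "smooth f" "smooth g" "smooth h"
  shows "smooth (\<lambda>p. vector [f p, g p, h p] :: real^3)"
proof -
  have "(\<lambda>p. vector [f p, g p, h p] :: real^3)
      = (\<lambda>p. f p *\<^sub>R axis 1 1 + g p *\<^sub>R axis 2 1 + h p *\<^sub>R axis 3 1)"
    by (simp add: fun_eq_iff vec_eq_iff forall_3 axis_def)
  then show ?thesis using assms by (auto intro!: smooth_add smooth_scaleR)
qed

lemma smooth_heis_christoffel:
  assumes "smooth X" "smooth Y"
  shows "smooth (\<lambda>p. heis_christoffel p (X p) (Y p))"
proof -
  have id: "smooth (\<lambda>p. p $ i)" for i :: 3
    by (rule smooth_bounded_linear[OF bounded_linear_vec_nth])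
  note rules = smooth_add smooth_mult smooth_component id smooth_const
  have form: "smooth (\<lambda>p. heis_form p (Z p))" if "smooth Z" for Z
  proof -
    have "(\<lambda>p. heis_form p (Z p)) = (\<lambda>p. Z p$3 + (1/2) * p$2 * Z p$1 + (- (1/2)) * p$1 * Z p$2)"
      by (simp add: heis_form_def fun_eq_iff)
    then show ?thesis by (simp only:) (intro rules that)
  qed
  define a where
    "a p = (1/2) * (heis_form p (Y p) * X p$2 + heis_form p (X p) * Y p$2)" for p
  define b where
    "b p = (- 1/2) * (heis_form p (Y p) * X p$1 + heis_form p (X p) * Y p$1)" for p
  have ab: "smooth a" "smooth b"
    unfolding a_def b_def by (intro rules form assms)+
  have "(\<lambda>p. heis_christoffel p (X p) (Y p))
      = (\<lambda>p. vector [a p, b p, (1/2) * p$1 * b p + (- 1/2) * p$2 * a p])"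
    by (simp add: heis_christoffel_def Let_def a_def b_def fun_eq_iff vec_eq_iff forall_3 field_simps)
  then show ?thesis by (simp only:) (intro smooth_vector3 rules ab)
qed

lemma heis_christoffel_sym: "heis_christoffel p u v = heis_christoffel p v u"
  by (simp add: heis_christoffel_def Let_def algebra_simps)

lemma heis_christoffel_add:
  "heis_christoffel p (u + u') v = heis_christoffel p u v + heis_christoffel p u' v"
  by (simp add: heis_christoffel_def heis_form_def Let_def vec_eq_iff forall_3 field_simps)

lemma heis_christoffel_scaleR:
  "heis_christoffel p (c *\<^sub>R u) v = c *\<^sub>R heis_christoffel p u v"
  by (simp add: heis_christoffel_def heis_form_def Let_def vec_eq_iff forall_3 field_simps)

theorem levi_civita_heis_nabla: "levi_civita heis_metric heis_nabla"
  unfolding levi_civita_def affine_connection_def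
proof (intro conjI allI impI)
  fix X Y :: "real^3 \<Rightarrow> real^3"
  assume X: "smooth X" and Y: "smooth Y"
  have "heis_nabla X Y = (\<lambda>p. dir_deriv X Y p + heis_christoffel p (X p) (Y p))"
    by (simp add: heis_nabla_def fun_eq_iff)
  then show "smooth (heis_nabla X Y)"
    using X Y by (auto intro!: smooth_add smooth_dir_deriv smooth_heis_christoffel)
  show "heis_nabla X Y p - heis_nabla Y X p = lie_bracket X Y p" for p
    by (simp add: heis_nabla_def lie_bracket_def heis_christoffel_sym)
  fix f :: "real^3 \<Rightarrow> real" and p
  assume f: "smooth f"
  note D = smooth_has_derivative
  show "heis_nabla (\<lambda>q. f q *\<^sub>R X q) Y p = f p *\<^sub>R heis_nabla X Y p"
    by (simp add: heis_nabla_def dir_deriv_def heis_christoffel_scaleR algebra_simps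
        linear_scale[OF has_derivative_linear[OF D[OF Y]]])
  show "heis_nabla X (\<lambda>q. f q *\<^sub>R Y q) p = dir_deriv X f p *\<^sub>R Y p + f p *\<^sub>R heis_nabla X Y p"
    unfolding heis_nabla_def dir_deriv_eq[OF has_derivative_scaleR[OF D[OF f] D[OF Y]]]
    by (simp add: dir_deriv_def heis_christoffel_sym[of p "X p"] heis_christoffel_scaleR algebra_simps)
next
  fix X Y Z :: "real^3 \<Rightarrow> real^3" and p
  assume X: "smooth X" and Y: "smooth Y" and Z: "smooth Z"
  note D = smooth_has_derivative
  show "heis_nabla (\<lambda>q. X q + Y q) Z p = heis_nabla X Z p + heis_nabla Y Z p"
    by (simp add: heis_nabla_def dir_deriv_def heis_christoffel_add algebra_simps
        linear_add[OF has_derivative_linear[OF D[OF Z]]])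
  show "heis_nabla X (\<lambda>q. Y q + Z q) p = heis_nabla X Y p + heis_nabla X Z p"
    unfolding heis_nabla_def dir_deriv_eq[OF has_derivative_add[OF D[OF Y] D[OF Z]]]
    by (simp add: dir_deriv_def heis_christoffel_sym[of p "X p"] heis_christoffel_add algebra_simps)
  have c: "((\<lambda>q. W q $ i) has_derivative (\<lambda>v. frechet_derivative W (at p) v $ i)) (at p)"
    if "smooth W" for W :: "real^3 \<Rightarrow> real^3" and i
    using bounded_linear.has_derivative[OF bounded_linear_vec_nth D[OF that]] .
  have i: "((\<lambda>q. q $ i) has_derivative (\<lambda>v. v $ i)) (at p)" for i :: 3
    using bounded_linear_imp_has_derivative[OF bounded_linear_vec_nth] .
  have form: "((\<lambda>q. heis_form q (W q)) has_derivative
      (\<lambda>v. heis_form p (frechet_derivative W (at p) v) + (v$2 * W p$1 - v$1 * W p$2) / 2)) (at p)"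
    if "smooth W" for W :: "real^3 \<Rightarrow> real^3"
    unfolding heis_form_def divide_inverse
    by (rule has_derivative_eq_rhs, (rule has_derivative_add has_derivative_diff has_derivative_mult has_derivative_const c[OF that] i)+)
      (simp add: fun_eq_iff field_simps)
  have metric: "heis_metric = (\<lambda>q u v. u$1 * v$1 + u$2 * v$2 + heis_form q u * heis_form q v)"
    by (simp add: fun_eq_iff heis_metric_def heis_form_def)
  have der: "((\<lambda>q. heis_metric q (Y q) (Z q)) has_derivative
      (\<lambda>v. let y = frechet_derivative Y (at p) v; z = frechet_derivative Z (at p) v in
         y$1 * Z p$1 + Y p$1 * z$1 + y$2 * Z p$2 + Y p$2 * z$2
         + (heis_form p y + (v$2 * Y p$1 - v$1 * Y p$2) / 2) * heis_form p (Z p)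
         + heis_form p (Y p) * (heis_form p z + (v$2 * Z p$1 - v$1 * Z p$2) / 2))) (at p)"
    unfolding metric
    by (rule has_derivative_eq_rhs,
        (rule has_derivative_add has_derivative_mult c[OF Y] c[OF Z] form[OF Y] form[OF Z])+)
      (simp add: fun_eq_iff Let_def algebra_simps)
  show "dir_deriv X (\<lambda>q. heis_metric q (Y q) (Z q)) p
      = heis_metric p (heis_nabla X Y p) (Z p) + heis_metric p (Y p) (heis_nabla X Z p)"
    unfolding dir_deriv_eq[OF der]
    by (simp add: heis_nabla_def dir_deriv_def heis_christoffel_def heis_metric_def heis_form_def
        Let_def field_simps)
qed

end

theory Submission
  imports Defs
begin

text \<open>
  In components with respect to the left-invariant frame, the covariant derivative along a curve is
  \<open>v' + \<omega>(T) \<times> v\<close> with \<open>\<omega>(u) = (u\<^sub>1/2, u\<^sub>2/2, -u\<^sub>3/2)\<close>, and the curvature is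
  \<open>R(X,Y)Z = Q(X \<times> Y) \<times> Z\<close> with \<open>Q = diag(1/4, 1/4, -3/4)\<close>, so the problem is one about curves in
  Euclidean space. Differentiating \<open>|T| = 1\<close> three times shows that the tangential component of
  the bitension is \<open>-3 k k'\<close>, so \<open>k\<close> is constant, and positive as the curve is not a geodesic. The
  components along \<open>N\<close> and \<open>B\<close> are then \<open>k (1/4 - B\<^sub>3\<^sup>2 - k\<^sup>2 - \<tau>\<^sup>2)\<close> and \<open>k (N\<^sub>3 B\<^sub>3 - \<tau>')\<close>. If both
  vanish, differentiating the first and using \<open>B\<^sub>3' = (\<tau> + 1/2) N\<^sub>3\<close> gives
  \<open>N\<^sub>3 B\<^sub>3 (2 \<tau> + 1/2) = 0\<close>. Hence \<open>\<tau>\<close> is the constant \<open>-1/4\<close> on the open set where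
  \<open>N\<^sub>3 B\<^sub>3 = \<tau>' \<noteq> 0\<close>, which is therefore empty.
\<close>

section \<open>Uniqueness of the Levi-Civita connection\<close>

lemma levi_civita_torsion_free:
  "levi_civita g nabla \<Longrightarrow> smooth X \<Longrightarrow> smooth Y \<Longrightarrow> nabla X Y p - nabla Y X p = lie_bracket X Y p"
  unfolding levi_civita_def by (elim conjE) (drule spec mp | assumption)+

lemma levi_civita_metric:
  "levi_civita g nabla \<Longrightarrow> smooth X \<Longrightarrow> smooth Y \<Longrightarrow> smooth Z \<Longrightarrow>
     dir_deriv X (\<lambda>q. g q (Y q) (Z q)) p = g p (nabla X Y p) (Z p) + g p (Y p) (nabla X Z p)"
  unfolding levi_civita_def by blast

text \<open>The difference of the two connections, paired with a third field, is symmetric in its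
  first two slots because both are torsion-free, and skew in the last two because both are metric.
  Together these force it to vanish.\<close>

lemma levi_civita_unique:
  assumes sym: "\<And>p u v. g p u v = g p v u"
    and diff: "\<And>p u v w. g p (u - v) w = g p u w - g p v w"
    and pos: "\<And>p u. u \<noteq> 0 \<Longrightarrow> g p u u > 0"
    and LC: "levi_civita g nabla" "levi_civita g nabla'"
    and XY: "smooth X" "smooth Y"
  shows "nabla X Y = nabla' X Y"
proof
  fix p
  define S where "S X Y Z = g p (nabla X Y p - nabla' X Y p) (Z p)" for X Y Z
  have S12: "S X Y Z = S Y X Z" if "smooth X" "smooth Y" for X Y Z
  proof -
    have "nabla X Y p - nabla' X Y p = nabla Y X p - nabla' Y X p"
      using levi_civita_torsion_free[OF LC(1) that, of p]
        levi_civita_torsion_free[OF LC(2) that, of p] by (simp add: algebra_simps)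
    then show ?thesis by (simp add: S_def)
  qed
  have S23: "S X Y Z = - S X Z Y" if "smooth X" "smooth Y" "smooth Z" for X Y Z
    using levi_civita_metric[OF LC(1) that, of p] levi_civita_metric[OF LC(2) that, of p]
    by (simp add: S_def diff sym[of p "Y p"])
  define z where "z = nabla X Y p - nabla' X Y p"
  \<comment> \<open>Alternating the two symmetries six times returns the arguments to their places
    after three sign changes. The constant field \<open>z\<close> extends the difference at
    \<open>p\<close>, so \<open>S X Y\<close> evaluated on it is \<open>g p z z\<close>.\<close>
  have "S X Y (\<lambda>_. z) = - S X Y (\<lambda>_. z)"
    using S12 S23 XY smooth_const[of z] by metis
  then have "g p z z = 0" by (simp add: S_def z_def)
  with pos[of z p] show "nabla X Y p = nabla' X Y p" by (force simp: z_def)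
qed

lemma levi_civita_heis_unique:
  assumes "levi_civita heis_metric nabla" "smooth X" "smooth Y"
  shows "nabla X Y = heis_nabla X Y"
  by (rule levi_civita_unique[OF _ _ heis_metric_pos assms(1) levi_civita_heis_nabla assms(2,3)])
    (simp_all add: heis_metric_def algebra_simps add_divide_distrib diff_divide_distrib)

lemma dir_deriv_const [simp]: "dir_deriv X (\<lambda>_. c) p = 0"
  by (simp add: dir_deriv_eq[OF has_derivative_const])

text \<open>Both \<open>cov_deriv\<close> and \<open>curvature_at\<close> evaluate
  \<open>nabla\<close> on fields with constant coordinates, where only the Christoffel term
  survives.\<close>

lemma levi_civita_heis_const:
  assumes "levi_civita heis_metric nabla"
  shows "nabla (\<lambda>_. u) (\<lambda>_. v) = (\<lambda>p. heis_christoffel p u v)"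
  using levi_civita_heis_unique[OF assms smooth_const smooth_const]
  by (simp add: heis_nabla_def fun_eq_iff)


section \<open>The connection in the left-invariant frame\<close>

text \<open>The connection form of the left-invariant frame: orthonormality makes it skew, hence a
  cross product. For instance, the derivative of e2 along e1 is e3/2, and that of e1 along e3 is
  -e2/2.\<close>

definition heis_conn :: "real^3 \<Rightarrow> real^3 \<Rightarrow> real^3" where
  "heis_conn u v = cross3 (vector [u$1/2, u$2/2, - u$3/2]) v"

text \<open>The curvature operator on bivectors, identified with vectors by the cross product.\<close>

definition heis_curv_op :: "real^3 \<Rightarrow> real^3" where
  "heis_curv_op u = vector [u$1/4, u$2/4, - 3 * u$3/4]"

section \<open>Metric and cross product in frame components\<close>

lemma heis_comp_eq: "heis_comp p v = vector [v$1, v$2, heis_form p v]"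
  by (simp add: vec_eq_iff forall_3 heis_comp_def heis_metric_def heis_frame_def heis_form_def
      field_simps)

lemma heis_metric_comp: "heis_metric p u v = heis_comp p u \<bullet> heis_comp p v"
  by (simp add: heis_comp_eq heis_metric_def heis_form_def inner_vec_def sum_3)

lemma heis_comp_inject: "heis_comp p u = heis_comp p v \<longleftrightarrow> u = v"
  by (metis heis_comp_frame)

lemma heis_comp_linear:
  "heis_comp p (u + v) = heis_comp p u + heis_comp p v"
  "heis_comp p (u - v) = heis_comp p u - heis_comp p v"
  "heis_comp p (- u) = - heis_comp p u"
  "heis_comp p (c *\<^sub>R u) = c *\<^sub>R heis_comp p u"
  "heis_comp p 0 = 0"
  by (simp_all add: vec_eq_iff forall_3 heis_comp_eq heis_form_def algebra_simps
      add_divide_distrib diff_divide_distrib)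

lemma heis_comp_cross: "heis_comp p (heis_cross p u v) = cross3 (heis_comp p u) (heis_comp p v)"
  by (simp add: heis_cross_def vec_eq_iff forall_3 sum_3 heis_comp_eq heis_form_def heis_frame_def
      field_simps)

section \<open>The curvature in frame components\<close>

lemma dir_deriv_heis_christoffel:
  "dir_deriv (\<lambda>_. x) (\<lambda>p. heis_christoffel p v w) p =
     (let c = \<lambda>v. (x$2 * v$1 - x$1 * v$2) / 2;
          a = (heis_form p w * v$2 + heis_form p v * w$2) / 2;
          b = - (heis_form p w * v$1 + heis_form p v * w$1) / 2;
          a' = (c w * v$2 + c v * w$2) / 2;
          b' = - (c w * v$1 + c v * w$1) / 2
      in vector [a', b', x$1/2 * b + p$1/2 * b' - x$2/2 * a - p$2/2 * a'])"
proof -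
  define D where "D = frechet_derivative (\<lambda>p. heis_christoffel p v w) (at p)"
  have "smooth (\<lambda>p. heis_christoffel p v w)"
    by (intro smooth_heis_christoffel smooth_const)
  from smooth_has_derivative[OF this, of p]
  have D: "((\<lambda>p. heis_christoffel p v w) has_derivative D) (at p)" by (simp add: D_def)
  \<comment> \<open>Restriction to the line through \<open>p\<close> in direction \<open>x\<close>
    reduces the claim to real derivatives of the three coordinates. Along it
    \<open>heis_form\<close> of \<open>v\<close> has derivative \<open>c v\<close>, and
    \<open>a'\<close>, \<open>b'\<close> are the derivatives of \<open>a\<close>,
    \<open>b\<close>.\<close>
  have line: "((\<lambda>s. p + s *\<^sub>R x) has_derivative (\<lambda>s. s *\<^sub>R x)) (at 0)"
    by (auto intro!: derivative_eq_intros)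
  have "((\<lambda>s. heis_christoffel (p + s *\<^sub>R x) v w) has_derivative (\<lambda>s. D (s *\<^sub>R x))) (at 0)"
    using has_derivative_compose[OF line, of "\<lambda>p. heis_christoffel p v w" D] D by simp
  then have "((\<lambda>s. heis_christoffel (p + s *\<^sub>R x) v w) has_vector_derivative D x) (at 0)"
    by (simp add: has_vector_derivative_def linear_scale[OF has_derivative_linear[OF D]])
  from bounded_linear.has_vector_derivative[OF bounded_linear_vec_nth this]
  have comp: "((\<lambda>s. heis_christoffel (p + s *\<^sub>R x) v w $ k) has_field_derivative D x $ k) (at 0)"
    for k by (simp add: has_real_derivative_iff_has_vector_derivative)
  have "D x $ 1 = (let c = \<lambda>v. (x$2 * v$1 - x$1 * v$2) / 2 in (c w * v$2 + c v * w$2) / 2)"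
    by (rule DERIV_unique[OF comp])
      (auto simp: heis_christoffel_def heis_form_def Let_def field_simps intro!: derivative_eq_intros)
  moreover have "D x $ 2 = (let c = \<lambda>v. (x$2 * v$1 - x$1 * v$2) / 2 in - (c w * v$1 + c v * w$1) / 2)"
    by (rule DERIV_unique[OF comp])
      (auto simp: heis_christoffel_def heis_form_def Let_def field_simps intro!: derivative_eq_intros)
  moreover have "D x $ 3 = (let c = \<lambda>v. (x$2 * v$1 - x$1 * v$2) / 2;
          a = (heis_form p w * v$2 + heis_form p v * w$2) / 2;
          b = - (heis_form p w * v$1 + heis_form p v * w$1) / 2;
          a' = (c w * v$2 + c v * w$2) / 2;
          b' = - (c w * v$1 + c v * w$1) / 2
      in x$1/2 * b + p$1/2 * b' - x$2/2 * a - p$2/2 * a')"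
    by (rule DERIV_unique[OF comp], unfold heis_christoffel_def heis_form_def Let_def)
      (auto simp: field_simps intro!: derivative_eq_intros)
  ultimately show ?thesis
    by (simp add: dir_deriv_def D_def[symmetric] vec_eq_iff forall_3 Let_def)
qed

text \<open>Constant extensions commute, so the bracket term drops out; what remains are derivatives
  of Christoffel terms and their compositions.\<close>

lemma heis_comp_curvature:
  assumes LC: "levi_civita heis_metric nabla"
  shows "heis_comp p (curvature_at nabla p u v w)
    = cross3 (heis_curv_op (cross3 (heis_comp p u) (heis_comp p v))) (heis_comp p w)"
proof -
  have sm: "smooth (\<lambda>p. heis_christoffel p u v)" for u v
    by (intro smooth_heis_christoffel smooth_const)
  have "lie_bracket (\<lambda>_. u) (\<lambda>_. v) = (\<lambda>_. 0)"
    by (simp add: lie_bracket_def fun_eq_iff)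
  moreover have "heis_christoffel p 0 w = 0"
    using heis_christoffel_scaleR[of p 0 0 w] by simp
  ultimately have eq: "curvature_at nabla p u v w
    = - (dir_deriv (\<lambda>_. u) (\<lambda>p. heis_christoffel p v w) p
         + heis_christoffel p u (heis_christoffel p v w))
      + (dir_deriv (\<lambda>_. v) (\<lambda>p. heis_christoffel p u w) p
         + heis_christoffel p v (heis_christoffel p u w))"
    by (simp add: curvature_at_def curvature_def levi_civita_heis_const[OF LC]
        levi_civita_heis_unique[OF LC smooth_const sm] heis_nabla_def)
  show ?thesis
    unfolding eq dir_deriv_heis_christoffel
    by (simp add: vec_eq_iff forall_3 heis_comp_eq heis_christoffel_def heis_form_def heis_curv_op_def
        cross3_def Let_def algebra_simps add_divide_distrib diff_divide_distrib)
qed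

section \<open>Calculus of covariant derivatives along a curve\<close>

lemma bounded_bilinear_cross3: "bounded_bilinear cross3"
  using bilinear_cross bilinear_conv_bounded_bilinear by blast

lemma bounded_bilinear_heis_conn: "bounded_bilinear heis_conn"
proof -
  have "bilinear heis_conn"
    unfolding bilinear_def heis_conn_def
    by (auto intro!: linearI simp: vec_eq_iff forall_3 cross3_def algebra_simps add_divide_distrib)
  then show ?thesis using bilinear_conv_bounded_bilinear by blast
qed

text \<open>\<open>w\<close> is the covariant derivative at \<open>t\<close> of the field with components \<open>v\<close>, along a curve whose
  velocity has components \<open>a\<close>.\<close>

definition has_cov :: "(real \<Rightarrow> real^3) \<Rightarrow> (real \<Rightarrow> real^3) \<Rightarrow> real^3 \<Rightarrow> real \<Rightarrow> bool" where
  "has_cov a v w t \<longleftrightarrow> (v has_vector_derivative (w - heis_conn (a t) (v t))) (at t)"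

text \<open>Metric compatibility: the connection acts on both factors as the cross product with one
  vector, which is skew, so its contributions cancel.\<close>

lemma has_cov_inner:
  assumes "has_cov a u u' t" "has_cov a v v' t"
  shows "((\<lambda>s. u s \<bullet> v s) has_real_derivative (u' \<bullet> v t + u t \<bullet> v')) (at t)"
proof -
  have "((\<lambda>s. u s \<bullet> v s) has_vector_derivative
      (u t \<bullet> (v' - heis_conn (a t) (v t)) + (u' - heis_conn (a t) (u t)) \<bullet> v t)) (at t)"
    using bounded_bilinear.has_vector_derivative[OF bounded_bilinear_inner] assms
    unfolding has_cov_def by blast
  also have "u t \<bullet> (v' - heis_conn (a t) (v t)) + (u' - heis_conn (a t) (u t)) \<bullet> v t
      = u' \<bullet> v t + u t \<bullet> v'"
    by (simp add: heis_conn_def cross3_def inner_vec_def sum_3 algebra_simps)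
  finally show ?thesis by (simp add: has_real_derivative_iff_has_vector_derivative)
qed

text \<open>By the Jacobi identity, the cross product with a fixed vector is a derivation of
  \<open>cross3\<close>, so the product rule has no connection term.\<close>

lemma has_cov_cross3:
  assumes "has_cov a u u' t" "has_cov a v v' t"
  shows "has_cov a (\<lambda>s. cross3 (u s) (v s)) (cross3 u' (v t) + cross3 (u t) v') t"
proof -
  have "((\<lambda>s. cross3 (u s) (v s)) has_vector_derivative
      (cross3 (u t) (v' - heis_conn (a t) (v t)) + cross3 (u' - heis_conn (a t) (u t)) (v t))) (at t)"
    using bounded_bilinear.has_vector_derivative[OF bounded_bilinear_cross3] assms
    unfolding has_cov_def by blast
  also have "cross3 (u t) (v' - heis_conn (a t) (v t)) + cross3 (u' - heis_conn (a t) (u t)) (v t)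
      = cross3 u' (v t) + cross3 (u t) v' - heis_conn (a t) (cross3 (u t) (v t))"
    by (simp add: heis_conn_def vec_eq_iff forall_3 cross3_def algebra_simps add_divide_distrib
        diff_divide_distrib)
  finally show ?thesis by (simp add: has_cov_def)
qed

lemma has_cov_scaleR:
  assumes "has_cov a u u' t"
  shows "has_cov a (\<lambda>s. c *\<^sub>R u s) (c *\<^sub>R u') t"
proof -
  have "((\<lambda>s. c *\<^sub>R u s) has_vector_derivative c *\<^sub>R (u' - heis_conn (a t) (u t))) (at t)"
    using bounded_linear.has_vector_derivative[OF bounded_linear_scaleR_right] assms
    unfolding has_cov_def by blast
  then show ?thesis
    by (simp add: has_cov_def scaleR_right_diff_distrib
        bounded_bilinear.scaleR_right[OF bounded_bilinear_heis_conn])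
qed

text \<open>The field e3 is not parallel, hence the correction; it involves only the first two
  components of the connection vector, both of which carry the factor 1/2.\<close>

lemma has_cov_component_3:
  assumes "has_cov a v w t"
  shows "((\<lambda>s. v s $ 3) has_real_derivative (w $ 3 - cross3 (a t) (v t) $ 3 / 2)) (at t)"
  using bounded_linear.has_vector_derivative[OF bounded_linear_vec_nth
      assms[unfolded has_cov_def], of 3]
  by (simp add: has_real_derivative_iff_has_vector_derivative heis_conn_def cross3_def
      algebra_simps diff_divide_distrib)

lemma has_cov_cong:
  assumes "has_cov a v w t" "open I" "t \<in> I" "\<And>s. s \<in> I \<Longrightarrow> v s = v' s"
  shows "has_cov a v' w t"
  using assms has_vector_derivative_transform_within_open[of v _ t I v']
  unfolding has_cov_def by metis

text \<open>This links the coordinate definition of \<open>cov_deriv\<close> to the calculus of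
  \<open>has_cov\<close>.\<close>

lemma heis_comp_cov_deriv:
  assumes LC: "levi_civita heis_metric nabla"
    and I: "open I" "t \<in> I"
    and \<gamma>: "(\<gamma> has_vector_derivative velocity \<gamma> t) (at t)"
    and a: "heis_comp (\<gamma> t) (velocity \<gamma> t) = a t"
    and v: "\<And>s. s \<in> I \<Longrightarrow> heis_comp (\<gamma> s) (V s) = v s"
    and cov: "has_cov a v w t"
  shows "heis_comp (\<gamma> t) (cov_deriv nabla \<gamma> V t) = w"
proof -
  define v' where "v' = w - heis_conn (a t) (v t)"
  have dv: "(v has_vector_derivative v') (at t)"
    using cov by (simp add: has_cov_def v'_def)
  have comp: "((\<lambda>s. v s $ i) has_vector_derivative v' $ i) (at t)"
    "((\<lambda>s. \<gamma> s $ i) has_vector_derivative velocity \<gamma> t $ i) (at t)" for i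
    using bounded_linear.has_vector_derivative[OF bounded_linear_vec_nth] dv \<gamma> by blast+
  \<comment> \<open>\<open>V'\<close> is the derivative of \<open>V\<close>, recovered from
    \<open>v\<close> by inverting \<open>heis_comp\<close>: only the third coordinate changes, by
    half of \<open>v$2 * \<gamma>$1 - v$1 * \<gamma>$2\<close>.\<close>
  define V' where "V' = v' + (v' $ 2 * \<gamma> t $ 1 / 2 + v t $ 2 * velocity \<gamma> t $ 1 / 2
     - v' $ 1 * \<gamma> t $ 2 / 2 - v t $ 1 * velocity \<gamma> t $ 2 / 2) *\<^sub>R axis 3 1"
  have "((\<lambda>s. v s + (v s $ 2 * \<gamma> s $ 1 / 2 - v s $ 1 * \<gamma> s $ 2 / 2) *\<^sub>R axis 3 1)
      has_vector_derivative V') (at t)"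
    unfolding V'_def using comp[of 1] comp[of 2] dv
    unfolding has_real_derivative_iff_has_vector_derivative[symmetric]
    by (auto intro!: derivative_eq_intros simp: algebra_simps add_divide_distrib)
  moreover have "v s + (v s $ 2 * \<gamma> s $ 1 / 2 - v s $ 1 * \<gamma> s $ 2 / 2) *\<^sub>R axis 3 1 = V s"
    if "s \<in> I" for s
    by (simp add: v[OF that, symmetric] heis_comp_eq heis_form_def vec_eq_iff forall_3 axis_def)
  ultimately have "(V has_vector_derivative V') (at t)"
    using has_vector_derivative_transform_within_open[OF _ I] by blast
  then have eq: "cov_deriv nabla \<gamma> V t = V' + heis_christoffel (\<gamma> t) (velocity \<gamma> t) (V t)"
    by (simp add: cov_deriv_def vector_derivative_at levi_civita_heis_const[OF LC])
  have w: "w = v' + heis_conn (a t) (v t)" by (simp add: v'_def)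
  show ?thesis
    unfolding eq w V'_def
    by (simp add: heis_conn_def cross3_def a[symmetric] v[OF I(2), symmetric] heis_comp_eq
        heis_christoffel_def heis_form_def Let_def vec_eq_iff forall_3 axis_def
        algebra_simps add_divide_distrib diff_divide_distrib)
qed


section \<open>Unit speed curves in terms of frame components\<close>

text \<open>For the unit vector \<open>b = cross3 a n\<close>, the part of \<open>v\<close>
  orthogonal to \<open>b\<close> is \<open>cross3 b (cross3 v b)\<close>; the Lagrange identity
  expands it in \<open>a\<close> and \<open>n\<close>.\<close>

lemma orthonormal_expansion_cross3:
  fixes a n v :: "real^3"
  assumes "a \<bullet> a = 1" "n \<bullet> n = 1" "a \<bullet> n = 0"
  shows "v = (v \<bullet> a) *\<^sub>R a + (v \<bullet> n) *\<^sub>R n + (v \<bullet> cross3 a n) *\<^sub>R cross3 a n"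
proof -
  define b where "b = cross3 a n"
  have b: "b \<bullet> b = 1" "cross3 b a = n" "cross3 b n = - a"
    using assms cross_skew[of b] by (simp_all add: b_def dot_cross Lagrange inner_commute)
  have "v - (v \<bullet> b) *\<^sub>R b = cross3 b (cross3 v b)"
    using b by (simp add: Lagrange inner_commute)
  also have "cross3 v b = (v \<bullet> n) *\<^sub>R a - (v \<bullet> a) *\<^sub>R n"
    by (simp add: b_def Lagrange)
  also have "cross3 b \<dots> = (v \<bullet> n) *\<^sub>R n + (v \<bullet> a) *\<^sub>R a"
    by (simp add: b Cross3.right_diff_distrib cross_mult_right)
  finally show ?thesis by (simp add: b_def algebra_simps)
qed

text \<open>This is the device for differentiating identities such as
  \<open>a t \<bullet> a t = 1\<close> that hold on an open set.\<close>

lemma DERIV_const_on_open: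
  fixes f :: "real \<Rightarrow> real"
  assumes "(f has_real_derivative D) (at t)" "open I" "t \<in> I" "\<And>s. s \<in> I \<Longrightarrow> f s = c"
  shows "D = 0"
proof -
  have "((\<lambda>_. c) has_real_derivative D) (at t)"
    by (rule has_field_derivative_transform_within_open[OF assms(1-3)]) (use assms(4) in auto)
  then show ?thesis using DERIV_unique DERIV_const by blast
qed

text \<open>The operator is 1/4 times the identity minus the projection onto e3. This is the source
  of the 1/4 and of the third components in the characterization.\<close>

lemma heis_curv_op_inner: "heis_curv_op u \<bullet> v = (u \<bullet> v) / 4 - u $ 3 * v $ 3"
  by (simp add: heis_curv_op_def inner_vec_def sum_3 field_simps)

text \<open>\<open>a\<close> stands for the components of \<open>T\<close> in the frame, and \<open>d\<^sub>j\<close> for those of its \<open>j\<close>-th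
  covariant derivative.\<close>

locale heis_unit_curve =
  fixes I :: "real set" and a d1 d2 d3 :: "real \<Rightarrow> real^3"
  assumes I: "open I" "is_interval I"
    and unit: "\<And>t. t \<in> I \<Longrightarrow> a t \<bullet> a t = 1"
    and cov1: "\<And>t. t \<in> I \<Longrightarrow> has_cov a a (d1 t) t"
    and cov2: "\<And>t. t \<in> I \<Longrightarrow> has_cov a d1 (d2 t) t"
    and cov3: "\<And>t. t \<in> I \<Longrightarrow> has_cov a d2 (d3 t) t"
begin

definition bitens :: "real \<Rightarrow> real^3" where
  "bitens t = d3 t + cross3 (heis_curv_op (cross3 (a t) (d1 t))) (a t)"

lemma constant_on_I:
  fixes f :: "real \<Rightarrow> real"
  assumes "\<And>t. t \<in> I \<Longrightarrow> (f has_real_derivative 0) (at t)"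
  shows "\<exists>c. \<forall>t\<in>I. f t = c"
  using has_field_derivative_zero_constant[of I f] assms I
  by (metis is_interval_convex_1 has_field_derivative_at_within)

section \<open>Consequences of unit speed\<close>

lemma inner_d1: "t \<in> I \<Longrightarrow> a t \<bullet> d1 t = 0"
  using DERIV_const_on_open[OF has_cov_inner[OF cov1 cov1] I(1) _ unit]
  by (simp add: inner_commute)

lemma inner_d2: "t \<in> I \<Longrightarrow> d1 t \<bullet> d1 t + a t \<bullet> d2 t = 0"
  using DERIV_const_on_open[OF has_cov_inner[OF cov1 cov2] I(1) _ inner_d1] by simp

lemma inner_d3:
  assumes "t \<in> I"
  shows "3 * (d1 t \<bullet> d2 t) + a t \<bullet> d3 t = 0"
  using DERIV_const_on_open[OF DERIV_add[OF has_cov_inner[OF cov2 cov2]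
        has_cov_inner[OF cov1 cov3]] I(1) _ inner_d2] assms
  by (simp add: inner_commute)

text \<open>The curvature term is a cross product with \<open>a t\<close>, so the tangential
  component of the bitension is that of \<open>d3 t\<close>, which is
  \<open>-3 * (d1 t \<bullet> d2 t)\<close>; the squared curvature has derivative
  \<open>2 * (d1 t \<bullet> d2 t)\<close>.\<close>

lemma bitens_zero_imp_curvature_constant:
  assumes "\<And>t. t \<in> I \<Longrightarrow> bitens t = 0"
  shows "\<exists>c. \<forall>t\<in>I. d1 t \<bullet> d1 t = c"
proof (rule constant_on_I)
  fix t assume t: "t \<in> I"
  have "a t \<bullet> bitens t = a t \<bullet> d3 t"
    by (simp add: bitens_def inner_add_right dot_cross_self)
  with assms[OF t] inner_d3[OF t] have "d1 t \<bullet> d2 t = 0" by simp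
  then show "((\<lambda>t. d1 t \<bullet> d1 t) has_real_derivative 0) (at t)"
    using has_cov_inner[OF cov2[OF t] cov2[OF t]] by (simp add: inner_commute)
qed

end

section \<open>The Frenet frame for constant positive curvature\<close>

locale heis_constant_curvature = heis_unit_curve +
  fixes k :: real
  assumes k: "k > 0" "\<And>t. t \<in> I \<Longrightarrow> d1 t \<bullet> d1 t = k\<^sup>2"
begin

definition n :: "real \<Rightarrow> real^3" where "n t = (1 / k) *\<^sub>R d1 t"
definition b :: "real \<Rightarrow> real^3" where "b t = cross3 (a t) (n t)"
text \<open>Since \<open>k\<close> is constant, \<open>d2\<close> is \<open>k\<close> times the
  covariant derivative of \<open>n\<close>; the sign is that of the Frenet equation whose right-hand
  side contains -\<tau>B.\<close>

definition torsion :: "real \<Rightarrow> real" where "torsion t = - (d2 t \<bullet> b t) / k"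

lemma d1_eq: "d1 t = k *\<^sub>R n t"
  using k by (simp add: n_def)

lemma frame:
  assumes "t \<in> I"
  shows "a t \<bullet> n t = 0" "n t \<bullet> n t = 1" "a t \<bullet> b t = 0" "n t \<bullet> b t = 0" "b t \<bullet> b t = 1"
    "cross3 (a t) (b t) = - n t"
proof -
  show an: "a t \<bullet> n t = 0" and nn: "n t \<bullet> n t = 1"
    using inner_d1[OF assms] k(1) k(2)[OF assms] by (simp_all add: n_def power2_eq_square)
  show "a t \<bullet> b t = 0" "n t \<bullet> b t = 0" by (simp_all add: b_def dot_cross_self)
  show "b t \<bullet> b t = 1"
    using an nn unit[OF assms] by (simp add: b_def dot_cross inner_commute)
  show "cross3 (a t) (b t) = - n t"
    using an unit[OF assms] by (simp add: b_def Lagrange)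
qed

lemma expansion:
  "t \<in> I \<Longrightarrow> v = (v \<bullet> a t) *\<^sub>R a t + (v \<bullet> n t) *\<^sub>R n t + (v \<bullet> b t) *\<^sub>R b t"
  unfolding b_def by (intro orthonormal_expansion_cross3 unit frame)

lemma d1_d2: "t \<in> I \<Longrightarrow> d1 t \<bullet> d2 t = 0"
  using DERIV_const_on_open[OF has_cov_inner[OF cov2 cov2] I(1) _ k(2)]
  by (simp add: inner_commute)

lemma n_d2: "t \<in> I \<Longrightarrow> n t \<bullet> d2 t = 0"
  using d1_d2 by (simp add: n_def)

lemma d2_eq:
  assumes "t \<in> I"
  shows "d2 t = - k\<^sup>2 *\<^sub>R a t - (k * torsion t) *\<^sub>R b t"
proof -
  have "d2 t \<bullet> a t = - k\<^sup>2" "d2 t \<bullet> n t = 0" "d2 t \<bullet> b t = - (k * torsion t)"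
    using inner_d2[OF assms] n_d2[OF assms] k(1) k(2)[OF assms]
    by (simp_all add: inner_commute torsion_def)
  with expansion[OF assms, of "d2 t"] show ?thesis by simp
qed

lemma cov_n:
  assumes "t \<in> I"
  shows "has_cov a n (- k *\<^sub>R a t - torsion t *\<^sub>R b t) t"
proof -
  have "has_cov a n ((1 / k) *\<^sub>R d2 t) t"
    using has_cov_scaleR[OF cov2[OF assms], of "1 / k"] by (simp add: n_def[abs_def])
  moreover have "(1 / k) *\<^sub>R d2 t = - k *\<^sub>R a t - torsion t *\<^sub>R b t"
    using k(1) by (simp add: d2_eq[OF assms] scaleR_right_diff_distrib power2_eq_square)
  ultimately show ?thesis by simp
qed

lemma cov_b:
  assumes "t \<in> I"
  shows "has_cov a b (torsion t *\<^sub>R n t) t"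
proof -
  \<comment> \<open>In the product rule for \<open>cross3 (a t) (n t)\<close> the first term
    vanishes because \<open>d1\<close> is parallel to \<open>n\<close>; in the second only
    \<open>- torsion t *\<^sub>R b t\<close> contributes, as
    \<open>cross3 (a t) (b t) = - n t\<close>.\<close>
  have "cross3 (d1 t) (n t) + cross3 (a t) (- k *\<^sub>R a t - torsion t *\<^sub>R b t) = torsion t *\<^sub>R n t"
    by (simp add: d1_eq Cross3.right_diff_distrib cross_mult_left cross_mult_right frame[OF assms])
  with has_cov_cross3[OF cov1[OF assms] cov_n[OF assms]] show ?thesis
    by (simp add: b_def[abs_def])
qed

lemma torsion_deriv:
  assumes "t \<in> I"
  shows "(torsion has_real_derivative - (d3 t \<bullet> b t) / k) (at t)"
proof -
  have "((\<lambda>t. d2 t \<bullet> b t) has_real_derivative d3 t \<bullet> b t) (at t)"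
    using has_cov_inner[OF cov3[OF assms] cov_b[OF assms]] n_d2[OF assms]
    by (simp add: inner_commute)
  from DERIV_cdivide[OF DERIV_minus[OF this], of k] show ?thesis
    by (simp add: torsion_def[abs_def])
qed

text \<open>The summand 1/2 is the connection correction of the third component, evaluated with
  \<open>cross3 (a t) (b t) = - n t\<close>.\<close>

lemma b3_deriv:
  "t \<in> I \<Longrightarrow> ((\<lambda>t. b t $ 3) has_real_derivative (torsion t + 1/2) * n t $ 3) (at t)"
  using has_cov_component_3[OF cov_b] by (simp add: frame algebra_simps)

section \<open>The bitension in the Frenet frame\<close>

lemma d3_inner_n:
  assumes "t \<in> I"
  shows "d3 t \<bullet> n t = - k * (k\<^sup>2 + (torsion t)\<^sup>2)"
proof -
  \<comment> \<open>This differentiates \<open>d1 t \<bullet> d2 t = 0\<close>, which expresses the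
    constancy of the curvature.\<close>
  have "d2 t \<bullet> d2 t + d1 t \<bullet> d3 t = 0"
    using DERIV_const_on_open[OF has_cov_inner[OF cov2 cov3] I(1) _ d1_d2] assms by simp
  moreover have "d2 t \<bullet> d2 t = k\<^sup>2 * (k\<^sup>2 + (torsion t)\<^sup>2)"
    unfolding d2_eq[OF assms]
    by (simp add: inner_diff_left inner_diff_right frame[OF assms] unit[OF assms]
        inner_commute[of "b t" "a t"] power2_eq_square algebra_simps)
  ultimately have "k * (d3 t \<bullet> n t + k * (k\<^sup>2 + (torsion t)\<^sup>2)) = 0"
    by (simp add: d1_eq inner_commute power2_eq_square algebra_simps)
  with k(1) show ?thesis by simp
qed

text \<open>The tangential component vanishes for constant \<open>k\<close>, so the conditions are
  those along \<open>n\<close> and \<open>b\<close>. By \<open>torsion_deriv\<close>,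
  \<open>- (d3 t \<bullet> b t) / k\<close> is the derivative of the torsion.\<close>

lemma bitens_zero_iff:
  assumes t: "t \<in> I"
  shows "bitens t = 0 \<longleftrightarrow>
    k\<^sup>2 + (torsion t)\<^sup>2 = 1/4 - (b t $ 3)\<^sup>2 \<and> - (d3 t \<bullet> b t) / k = n t $ 3 * b t $ 3"
proof -
  have bit: "bitens t = d3 t + k *\<^sub>R cross3 (heis_curv_op (b t)) (a t)"
  proof -
    have "heis_curv_op (k *\<^sub>R b t) = k *\<^sub>R heis_curv_op (b t)"
      by (simp add: heis_curv_op_def vec_eq_iff forall_3)
    then show ?thesis
      by (simp add: bitens_def d1_eq cross_mult_right cross_mult_left b_def[symmetric])
  qed
  \<comment> \<open>Cyclicity of the triple product turns the curvature terms into values of the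
    bilinear form of \<open>heis_curv_op\<close>: at \<open>b\<close>, \<open>b\<close> for the
    \<open>n\<close>-component and at \<open>b\<close>, \<open>- n\<close> for the
    \<open>b\<close>-component.\<close>
  have triple: "cross3 (heis_curv_op (b t)) (a t) \<bullet> v = heis_curv_op (b t) \<bullet> cross3 (a t) v" for v
    by (metis cross_triple inner_commute)
  have "d3 t \<bullet> a t = 0"
    using inner_d3[OF t] d1_d2[OF t] by (simp add: inner_commute)
  then have "bitens t \<bullet> a t = 0"
    by (simp add: bit inner_add_left dot_cross_self)
  moreover have "bitens t \<bullet> n t = k * (1/4 - (b t $ 3)\<^sup>2 - k\<^sup>2 - (torsion t)\<^sup>2)"
    by (simp add: bit inner_add_left triple b_def[symmetric] heis_curv_op_inner frame[OF t]
        d3_inner_n[OF t] power2_eq_square algebra_simps)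
  moreover have "bitens t \<bullet> b t = k * (n t $ 3 * b t $ 3 + (d3 t \<bullet> b t) / k)"
    using k(1)
    by (simp add: bit inner_add_left triple frame[OF t] heis_curv_op_inner
        inner_commute[of "b t" "n t"] algebra_simps)
  moreover have "bitens t = 0 \<longleftrightarrow> bitens t \<bullet> a t = 0 \<and> bitens t \<bullet> n t = 0 \<and> bitens t \<bullet> b t = 0"
    using expansion[OF t, of "bitens t"] by auto
  ultimately show ?thesis using k(1) by auto
qed

lemma bitens_zero_on_iff:
  "(\<forall>t\<in>I. bitens t = 0) \<longleftrightarrow>
    (\<exists>\<tau>. \<forall>t\<in>I. torsion t = \<tau>) \<and> (\<forall>t\<in>I. n t $ 3 * b t $ 3 = 0) \<and>
    (\<forall>t\<in>I. k\<^sup>2 + (torsion t)\<^sup>2 = 1/4 - (b t $ 3)\<^sup>2)"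
proof (intro iffI conjI)
  assume R: "(\<exists>\<tau>. \<forall>t\<in>I. torsion t = \<tau>) \<and> (\<forall>t\<in>I. n t $ 3 * b t $ 3 = 0) \<and>
    (\<forall>t\<in>I. k\<^sup>2 + (torsion t)\<^sup>2 = 1/4 - (b t $ 3)\<^sup>2)"
  show "\<forall>t\<in>I. bitens t = 0"
  proof
    fix t assume t: "t \<in> I"
    have "- (d3 t \<bullet> b t) / k = 0"
      using DERIV_const_on_open[OF torsion_deriv[OF t] I(1) t] R by blast
    moreover have "n t $ 3 * b t $ 3 = 0" "k\<^sup>2 + (torsion t)\<^sup>2 = 1/4 - (b t $ 3)\<^sup>2"
      using R t by blast+
    ultimately show "bitens t = 0"
      unfolding bitens_zero_iff[OF t] by (simp only:)
  qed
next
  assume bit: "\<forall>t\<in>I. bitens t = 0"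
  define f where "f t = n t $ 3 * b t $ 3" for t
  have eq: "k\<^sup>2 + (torsion t)\<^sup>2 = 1/4 - (b t $ 3)\<^sup>2" if "t \<in> I" for t
    using bit that by (simp add: bitens_zero_iff)
  then show "\<forall>t\<in>I. k\<^sup>2 + (torsion t)\<^sup>2 = 1/4 - (b t $ 3)\<^sup>2" by blast
  have deriv: "(torsion has_real_derivative f t) (at t)" if "t \<in> I" for t
    using bit torsion_deriv[OF that] that by (simp add: bitens_zero_iff f_def)
  have prod: "f t * (2 * torsion t + 1/2) = 0" if t: "t \<in> I" for t
  proof -
    \<comment> \<open>The function equals the constant \<open>1/4 - k\<^sup>2\<close> on
      \<open>I\<close>, and its derivative collects to
      \<open>2 * f t * (2 * torsion t + 1/2)\<close>.\<close>
    have "((\<lambda>t. torsion t * torsion t + b t $ 3 * b t $ 3) has_real_derivative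
        f t * torsion t + f t * torsion t + ((torsion t + 1/2) * n t $ 3 * b t $ 3
        + (torsion t + 1/2) * n t $ 3 * b t $ 3)) (at t)"
      by (intro DERIV_add DERIV_mult deriv b3_deriv t)
    from DERIV_const_on_open[OF this I(1) t, of "1/4 - k\<^sup>2"]
    have "f t * torsion t + f t * torsion t + ((torsion t + 1/2) * n t $ 3 * b t $ 3
        + (torsion t + 1/2) * n t $ 3 * b t $ 3) = 0"
      using eq by (fastforce simp: power2_eq_square)
    then show ?thesis by (simp add: f_def algebra_simps)
  qed
  have "continuous_on I f"
    unfolding f_def
    using has_cov_component_3[OF cov_n] b3_deriv
    by (intro continuous_on_mult continuous_at_imp_continuous_on ballI)
      (blast intro: DERIV_isCont)+
  \<comment> \<open>Openness makes the torsion constant near each point of this set, so that its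
    derivative \<open>f\<close> vanishes there, a contradiction.\<close>
  then have "open (I \<inter> f -` (- {0}))"
    using I(1) by (intro continuous_open_preimage) auto
  have f0: "f t = 0" if t: "t \<in> I" for t
  proof (rule ccontr)
    assume "f t \<noteq> 0"
    then have "t \<in> I \<inter> f -` (- {0})" using t by simp
    moreover have "torsion s = - 1/4" if "s \<in> I \<inter> f -` (- {0})" for s
      using prod[of s] that by auto
    ultimately have "f t = 0"
      using DERIV_const_on_open[OF deriv[OF t] \<open>open (I \<inter> f -` (- {0}))\<close>] by blast
    with \<open>f t \<noteq> 0\<close> show False by simp
  qed
  then show "\<forall>t\<in>I. n t $ 3 * b t $ 3 = 0" by (simp add: f_def)
  show "\<exists>\<tau>. \<forall>t\<in>I. torsion t = \<tau>"
    using deriv f0 by (intro constant_on_I) simp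
qed

end


section \<open>Frame components of the Frenet apparatus\<close>

text \<open>In one variable a derivative is determined by its value at 1, so iterating that
  evaluation yields all higher vector derivatives.\<close>

lemma smooth_on_real_derivatives:
  fixes f :: "real \<Rightarrow> 'b::real_normed_vector"
  assumes "smooth_on I f"
  obtains F where "F 0 = f"
    "\<And>m t. t \<in> I \<Longrightarrow> (F m has_vector_derivative F (Suc m) t) (at t)"
proof -
  define F where "F m = ((\<lambda>f t. frechet_derivative f (at t) 1) ^^ m) f" for m
  have sm: "smooth_on I (F m)" for m
  proof (induction m)
    case 0
    then show ?case using assms by (simp add: F_def)
  next
    case (Suc m)
    then have "Ck_on (Suc k) I (F m)" for k by (simp only: smooth_on_def)
    then show ?case by (simp add: smooth_on_def F_def)
  qed
  have "(F m has_vector_derivative F (Suc m) t) (at t)" if "t \<in> I" for m t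
  proof -
    have "Ck_on 1 I (F m)" using sm[of m] unfolding smooth_on_def by blast
    then have "F m differentiable (at t)" using that by simp
    then have D: "(F m has_derivative frechet_derivative (F m) (at t)) (at t)"
      using frechet_derivative_works by blast
    have "frechet_derivative (F m) (at t) (h *\<^sub>R 1) = h *\<^sub>R F (Suc m) t" for h
      by (subst linear_scale[OF has_derivative_linear[OF D]]) (simp add: F_def)
    then have "frechet_derivative (F m) (at t) = (\<lambda>h. h *\<^sub>R F (Suc m) t)"
      by (simp add: fun_eq_iff)
    with D show ?thesis by (simp add: has_vector_derivative_def)
  qed
  then show thesis using that[of F] by (simp add: F_def)
qed

text \<open>\<open>heis_comp p v\<close> is only affine in \<open>p\<close>; subtracting
  \<open>v\<close> leaves the bilinear term in the third coordinate, to which the product rule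
  applies.\<close>

lemma bounded_bilinear_heis_comp_diff: "bounded_bilinear (\<lambda>p v. heis_comp p v - v)"
proof -
  have "bilinear (\<lambda>p v. heis_comp p v - v)"
    unfolding bilinear_def
    by (auto intro!: linearI simp: vec_eq_iff forall_3 heis_comp_eq heis_form_def algebra_simps
        add_divide_distrib)
  then show ?thesis using bilinear_conv_bounded_bilinear by blast
qed

lemma ex_heis_unit_curve:
  assumes I: "open I" "is_interval I" and sm: "smooth_on I \<gamma>"
    and arc: "arc_length_param heis_metric \<gamma> I"
  obtains d1 d2 d3 where "heis_unit_curve I (\<lambda>t. heis_comp (\<gamma> t) (velocity \<gamma> t)) d1 d2 d3"
proof -
  define a where "a t = heis_comp (\<gamma> t) (velocity \<gamma> t)" for t
  obtain g where g0: "g 0 = \<gamma>"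
    and g: "\<And>m t. t \<in> I \<Longrightarrow> (g m has_vector_derivative g (Suc m) t) (at t)"
    using smooth_on_real_derivatives[OF sm] by blast
  \<comment> \<open>the bilinear deviation of frame components from coordinates\<close>
  define C where "C p v = heis_comp p v - v" for p v
  note C = bounded_bilinear_heis_comp_diff[folded C_def]
  define G where "G i j t = C (g i t) (g j t)" for i j t
  have G: "(G i j has_vector_derivative G i (Suc j) t + G (Suc i) j t) (at t)" if "t \<in> I" for i j t
    unfolding G_def by (rule bounded_bilinear.has_vector_derivative[OF C g[OF that] g[OF that]])
  \<comment> \<open>\<open>A0\<close> gives the frame components of the velocity on
    \<open>I\<close>, and \<open>A1\<close>, \<open>A2\<close>, \<open>A3\<close> are its ordinary
    derivatives, with the summands grouped as the product rule produces them.\<close>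
  define A0 where "A0 t = g 1 t + G 0 1 t" for t
  define A1 where "A1 t = g 2 t + (G 0 2 t + G 1 1 t)" for t
  define A2 where "A2 t = g 3 t + ((G 0 3 t + G 1 2 t) + (G 1 2 t + G 2 1 t))" for t
  define A3 where "A3 t = g 4 t + (((G 0 4 t + G 1 3 t) + (G 1 3 t + G 2 2 t))
    + ((G 1 3 t + G 2 2 t) + (G 2 2 t + G 3 1 t)))" for t
  have suc: "Suc 0 = 1" "Suc 1 = 2" "Suc 2 = 3" "Suc 3 = 4" by simp_all
  have A: "(A0 has_vector_derivative A1 t) (at t)" "(A1 has_vector_derivative A2 t) (at t)"
    "(A2 has_vector_derivative A3 t) (at t)" if "t \<in> I" for t
    unfolding A0_def[abs_def] A1_def[abs_def] A2_def[abs_def] A3_def[abs_def]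
    by (intro has_vector_derivative_add g[OF that, of 1, unfolded suc] g[OF that, of 2, unfolded suc]
      g[OF that, of 3, unfolded suc] G[OF that, of 0 1, unfolded suc] G[OF that, of 0 2, unfolded suc]
      G[OF that, of 0 3, unfolded suc] G[OF that, of 1 1, unfolded suc]
      G[OF that, of 1 2, unfolded suc] G[OF that, of 2 1, unfolded suc])+
  have velocity: "velocity \<gamma> t = g 1 t" if "t \<in> I" for t
    using g[OF that, of 0] by (simp add: velocity_def g0 vector_derivative_at)
  have a_eq: "A0 t = a t" if "t \<in> I" for t
    by (simp add: A0_def a_def G_def C_def velocity[OF that] g0)
  define conn where "conn u v t = heis_conn (u t) (v t)" for u v :: "real \<Rightarrow> real^3" and t
  define d1 where "d1 t = A1 t + conn A0 A0 t" for t
  define d1' where "d1' t = A2 t + (conn A0 A1 t + conn A1 A0 t)" for t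
  define d2 where "d2 t = d1' t + conn A0 d1 t" for t
  \<comment> \<open>\<open>d1'\<close>, \<open>d1''\<close>, \<open>d2'\<close> are ordinary derivatives, \<open>d1\<close>, \<open>d2\<close>, \<open>d3\<close> covariant ones\<close>
  define d1'' where "d1'' t = A3 t + ((conn A0 A2 t + conn A1 A1 t) + (conn A1 A1 t + conn A2 A0 t))"
    for t
  define d2' where "d2' t = d1'' t + (conn A0 d1' t + conn A1 d1 t)" for t
  define d3 where "d3 t = d2' t + conn A0 d2 t" for t
  have conn_deriv: "(conn u v has_vector_derivative conn u v' t + conn u' v t) (at t)"
    if "(u has_vector_derivative u' t) (at t)" "(v has_vector_derivative v' t) (at t)" for u v u' v' t
    unfolding conn_def
    by (rule bounded_bilinear.has_vector_derivative[OF bounded_bilinear_heis_conn that])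
  have D1: "(d1 has_vector_derivative d1' t) (at t)" if "t \<in> I" for t
    unfolding d1_def[abs_def] d1'_def by (intro has_vector_derivative_add conn_deriv A that)
  have D1': "(d1' has_vector_derivative d1'' t) (at t)" if "t \<in> I" for t
    unfolding d1'_def[abs_def] d1''_def by (intro has_vector_derivative_add conn_deriv A that)
  have D2: "(d2 has_vector_derivative d2' t) (at t)" if "t \<in> I" for t
    unfolding d2_def[abs_def] d2'_def by (intro has_vector_derivative_add conn_deriv A D1 D1' that)
  have "heis_unit_curve I a d1 d2 d3"
  proof
    fix t assume t: "t \<in> I"
    show "a t \<bullet> a t = 1"
      using arc t by (simp add: arc_length_param_def a_def heis_metric_comp)
    have "has_cov a A0 (d1 t) t"
      using A(1)[OF t] by (simp add: has_cov_def d1_def conn_def a_eq[OF t])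
    then show "has_cov a a (d1 t) t"
      using has_cov_cong[OF _ I(1) t] a_eq by blast
    show "has_cov a d1 (d2 t) t"
      using D1[OF t] by (simp add: has_cov_def d2_def conn_def a_eq[OF t])
    show "has_cov a d2 (d3 t) t"
      using D2[OF t] by (simp add: has_cov_def d3_def conn_def a_eq[OF t])
  qed (fact I)+
  then show thesis using that by (simp add: a_def[abs_def])
qed

section \<open>From component curves to the Frenet apparatus of \<open>nabla\<close>\<close>

theorem theorem3p4:
  fixes nabla :: "(real^3 \<Rightarrow> real^3) \<Rightarrow> (real^3 \<Rightarrow> real^3) \<Rightarrow> real^3 \<Rightarrow> real^3"
    and \<gamma> :: "real \<Rightarrow> real^3"
    and I :: "real set"
  assumes "levi_civita heis_metric nabla"
    and "open I" and "is_interval I"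
    and "smooth_on I \<gamma>"
    and "arc_length_param heis_metric \<gamma> I"
    and "\<not> geodesic nabla \<gamma> I"
  shows "biharmonic nabla \<gamma> I \<longleftrightarrow>
    (\<exists>k. k \<noteq> 0 \<and> (\<forall>t\<in>I. geod_curvature nabla \<gamma> t = k)) \<and>
    (\<exists>\<tau>. \<forall>t\<in>I. frenet_torsion nabla \<gamma> t = \<tau>) \<and>
    (\<forall>t\<in>I. heis_comp (\<gamma> t) (frenet_N nabla \<gamma> t) $ 3
             * heis_comp (\<gamma> t) (frenet_B nabla \<gamma> t) $ 3 = 0) \<and>
    (\<forall>t\<in>I. (geod_curvature nabla \<gamma> t)\<^sup>2 + (frenet_torsion nabla \<gamma> t)\<^sup>2
             = 1/4 - (heis_comp (\<gamma> t) (frenet_B nabla \<gamma> t) $ 3)\<^sup>2)"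
proof -
  note LC = assms(1) and I = assms(2,3)
  define a where "a = (\<lambda>t. heis_comp (\<gamma> t) (velocity \<gamma> t))"
  have a: "heis_comp (\<gamma> t) (velocity \<gamma> t) = a t" for t by (simp add: a_def)
  obtain d1 d2 d3 where curve: "heis_unit_curve I a d1 d2 d3"
    unfolding a_def by (rule ex_heis_unit_curve[OF assms(2-5)])
  interpret heis_unit_curve I a d1 d2 d3 by (rule curve)
  have \<gamma>: "(\<gamma> has_vector_derivative velocity \<gamma> t) (at t)" if t: "t \<in> I" for t
  proof -
    have "\<gamma> differentiable (at t)"
      using assms(4) t Ck_on.simps(2)[of 0 I \<gamma>] unfolding smooth_on_def by blast
    then show ?thesis by (simp add: velocity_def vector_derivative_works[symmetric])
  qed
  note comp = heis_comp_cov_deriv[where a = a, OF LC I(1) _ \<gamma> a]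
  define DT where "DT = cov_deriv nabla \<gamma> (velocity \<gamma>)"
  have c1: "heis_comp (\<gamma> t) (DT t) = d1 t" if "t \<in> I" for t
    unfolding DT_def using comp[OF that that _ cov1[OF that]] by (simp add: a)
  have c2: "heis_comp (\<gamma> t) (cov_deriv nabla \<gamma> DT t) = d2 t" if "t \<in> I" for t
    using comp[OF that that c1 cov2[OF that]] by simp
  have c3: "heis_comp (\<gamma> t) (cov_deriv nabla \<gamma> (cov_deriv nabla \<gamma> DT) t) = d3 t" if "t \<in> I" for t
    using comp[OF that that c2 cov3[OF that]] by simp
  have "bitension nabla \<gamma> t = 0 \<longleftrightarrow> bitens t = 0" if t: "t \<in> I" for t
  proof -
    have "heis_comp (\<gamma> t) (bitension nabla \<gamma> t) = bitens t"
      by (simp add: bitension_def bitens_def DT_def[symmetric] heis_comp_linear c1[OF t] c3[OF t]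
          heis_comp_curvature[OF LC] a)
    then show ?thesis by (metis heis_comp_inject heis_comp_linear(5))
  qed
  then have biharmonic: "biharmonic nabla \<gamma> I \<longleftrightarrow> (\<forall>t\<in>I. bitens t = 0)"
    by (simp add: biharmonic_def)
  have curvature: "geod_curvature nabla \<gamma> t = sqrt (d1 t \<bullet> d1 t)" if "t \<in> I" for t
    by (simp add: geod_curvature_def heis_metric_comp DT_def[symmetric] c1[OF that])
  obtain t0 where t0: "t0 \<in> I" "d1 t0 \<noteq> 0"
  proof -
    obtain t0 where t0: "t0 \<in> I" "DT t0 \<noteq> 0"
      using assms(6) by (auto simp: geodesic_def DT_def)
    with c1[OF t0(1)] have "d1 t0 \<noteq> 0"
      by (metis heis_comp_inject heis_comp_linear(5))
    with t0(1) that show thesis by blast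
  qed
  let ?const = "\<exists>k. k \<noteq> 0 \<and> (\<forall>t\<in>I. geod_curvature nabla \<gamma> t = k)"
  let ?rest = "(\<exists>\<tau>. \<forall>t\<in>I. frenet_torsion nabla \<gamma> t = \<tau>) \<and>
    (\<forall>t\<in>I. heis_comp (\<gamma> t) (frenet_N nabla \<gamma> t) $ 3
             * heis_comp (\<gamma> t) (frenet_B nabla \<gamma> t) $ 3 = 0) \<and>
    (\<forall>t\<in>I. (geod_curvature nabla \<gamma> t)\<^sup>2 + (frenet_torsion nabla \<gamma> t)\<^sup>2
             = 1/4 - (heis_comp (\<gamma> t) (frenet_B nabla \<gamma> t) $ 3)\<^sup>2)"
  have bih_const: ?const if "\<forall>t\<in>I. bitens t = 0"
  proof -
    obtain c where "\<forall>t\<in>I. d1 t \<bullet> d1 t = c"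
      using bitens_zero_imp_curvature_constant \<open>\<forall>t\<in>I. bitens t = 0\<close> by blast
    \<comment> \<open>Failure to be a geodesic gives just one point \<open>t0\<close> with nonzero
      \<open>d1\<close>; the constancy of \<open>c\<close> carries this to all of
      \<open>I\<close>.\<close>
    with t0 show ?thesis by (intro exI[of _ "sqrt c"]) (auto simp: curvature)
  qed
  \<comment> \<open>Under \<open>?const\<close> the Frenet frame exists on all of \<open>I\<close>
    and can be identified with \<open>n\<close>, \<open>b\<close> and \<open>torsion\<close>; each
    direction of the theorem supplies \<open>?const\<close>.\<close>
  have const_iff: "(\<forall>t\<in>I. bitens t = 0) \<longleftrightarrow> ?rest" if ?const
  proof -
    obtain k where const: "\<And>t. t \<in> I \<Longrightarrow> geod_curvature nabla \<gamma> t = k" "k \<noteq> 0"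
      using \<open>?const\<close> by blast
    have pos: "k > 0" using const curvature[OF t0(1)] t0 by auto
    have "d1 t \<bullet> d1 t = k\<^sup>2" if "t \<in> I" for t
      using const(1)[OF that] curvature[OF that] by auto
    then interpret heis_constant_curvature I a d1 d2 d3 k
      using pos by unfold_locales
    have N: "heis_comp (\<gamma> t) (frenet_N nabla \<gamma> t) = n t" if "t \<in> I" for t
      by (simp add: frenet_N_def n_def const(1)[OF that] heis_comp_linear DT_def[symmetric] c1[OF that])
    have B: "heis_comp (\<gamma> t) (frenet_B nabla \<gamma> t) = b t" if "t \<in> I" for t
      by (simp add: frenet_B_def b_def heis_comp_cross N[OF that] a)
    have tors: "frenet_torsion nabla \<gamma> t = torsion t" if t: "t \<in> I" for t
      unfolding frenet_torsion_def
    \<comment> \<open>\<open>torsion t\<close> satisfies both Frenet equations by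
      \<open>cov_n\<close> and \<open>cov_b\<close>; uniqueness follows from the first alone, since
      \<open>b t\<close> is a unit vector.\<close>
    proof (rule the_equality)
      note DN = comp[OF t t N cov_n[OF t]] and DB = comp[OF t t B cov_b[OF t]]
      show "cov_deriv nabla \<gamma> (frenet_N nabla \<gamma>) t
          = - geod_curvature nabla \<gamma> t *\<^sub>R velocity \<gamma> t - torsion t *\<^sub>R frenet_B nabla \<gamma> t \<and>
        cov_deriv nabla \<gamma> (frenet_B nabla \<gamma>) t = torsion t *\<^sub>R frenet_N nabla \<gamma> t"
        by (subst (1 2) heis_comp_inject[of "\<gamma> t", symmetric])
          (simp add: heis_comp_linear DN DB N[OF t] B[OF t] const(1)[OF t] a)
      fix s
      assume "cov_deriv nabla \<gamma> (frenet_N nabla \<gamma>) t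
          = - geod_curvature nabla \<gamma> t *\<^sub>R velocity \<gamma> t - s *\<^sub>R frenet_B nabla \<gamma> t \<and>
        cov_deriv nabla \<gamma> (frenet_B nabla \<gamma>) t = s *\<^sub>R frenet_N nabla \<gamma> t"
      then have "- k *\<^sub>R a t - s *\<^sub>R b t = - k *\<^sub>R a t - torsion t *\<^sub>R b t"
        using DN by (simp add: heis_comp_linear B[OF t] const(1)[OF t] a)
      then show "s = torsion t"
        using frame(5)[OF t] by auto
    qed
    show ?thesis
      unfolding bitens_zero_on_iff by (simp add: N B tors const(1) cong: ball_cong)
  qed
  show ?thesis
    unfolding biharmonic
  proof (rule iffI)
    assume "\<forall>t\<in>I. bitens t = 0"
    then show "?const \<and> ?rest"
      by (intro conjI[OF bih_const iffD1[OF const_iff[OF bih_const]]])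
  next
    assume "?const \<and> ?rest"
    then show "\<forall>t\<in>I. bitens t = 0"
      by (elim conjE[of ?const ?rest] iffD2[OF const_iff])
  qed
qed

end
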